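(* Let $G$ be a finite nonabelian group, let $x,y\in G$ with $xy\neq yx$, and let $T$ be the unique component of $Y(G)$ which contains the triangle $[(x,1),(y,1),(xy,2)]$. Then all type 1 vertices in $T$ are (labelled by elements) conjugate to either $x$ or $y$, and all type 2 vertices in $T$ are (labelled by) conjugates of $xy$. Furthermore, all sheets about type 2 vertices in $T$ are simplicially isomorphic via a conjugation and hence are $n$-gons for the same $n\ge 3$. These conjugations are by elements in the subgroup $H=\langle x,y\rangle$ generated by $x$ and $y$. In the corresponding $2$-cell structure on $T$, all vertices are conjugate to (and hence have the same valency as) either $(x,1)$ or $(y,1)$. All faces are $n$-gons for the same $n$. All oriented edges are conjugate to the edge $[(x,1),(y,1)]$ or the edge $[(y,1),(y^{-1}xy,1)]$, and all unoriented edges are conjugate. Thus the cell automorphism group of the component is both face and edge transitive.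
   Context: For a finite nonabelian group $G$ with center $Z(G)$, $X(G)$ is the $2$-dimensional simplicial complex with vertex set $\{(x,1): x\in G-Z(G)\}\sqcup\{(x,2): x\in G-Z(G)\}$ (type 1 and type 2 vertices), whose edges are $[(x,1),(y,1)]$ and $[(x,1),(y,2)]$ for all $x,y$ with $xy\ne yx$, and whose $2$-faces are $[(x,1),(y,1),(xy,2)]$ for all ordered pairs with $xy\neq yx$, oriented by the vertex order indicated. The link of every vertex is a disjoint union of finitely many circles. The desingularization $Y(G)$ is obtained by removing all vertices of $X(G)$ and filling in distinct punctures by distinct points (one new vertex, again labelled by $v$ and of the same type, for each vertex $v$ and each circle in the link of $v$); it has the same triangles as $X(G)$ and is a finite disjoint union of compact connected oriented triangulated surfaces, its components. In $Y(G)$ the closed star of a vertex is a single triangulated disk (an $m$-gon coned to its center for some $m\ge 3$), called the sheet about that vertex. The $2$-cell structure on a component of $Y(G)$ is obtained by erasing all type 2 vertices and all edges joining type 1 to type 2 vertices: vertices are the type 1 vertices, edges are those joining two type 1 vertices, and $2$-faces are the polygons formed by the sheets about type 2 vertices. The valency of a vertex is the number of edges of this $2$-cell structure incident to it. Conjugation by an element of $G$ induces a simplicial automorphism of $X(G)$ and of $Y(G)$ (acting on the group element in the label of each vertex), and "conjugate" for vertices, edges and sheets means related by such an automorphism. A cell automorphism is a bijection of vertices carrying edges to edges and boundaries of $2$-faces to boundaries of $2$-faces. *)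

theory Defs
  imports "HOL-Algebra.Generated_Groups" "HOL-Algebra.Bij"
begin

section \<open>Abstract simplicial complexes\<close>

text \<open>A complex is the set of its nonempty simplices; its vertex set is \<open>\<Union>K\<close>.\<close>

definition simplicial_complex :: "'v set set \<Rightarrow> bool" where
  "simplicial_complex K \<longleftrightarrow>
     (\<forall>\<sigma>\<in>K. finite \<sigma> \<and> \<sigma> \<noteq> {} \<and> (\<forall>\<tau>. \<tau> \<noteq> {} \<and> \<tau> \<subseteq> \<sigma> \<longrightarrow> \<tau> \<in> K))"

definition simplicial_iso :: "('v \<Rightarrow> 'w) \<Rightarrow> 'v set set \<Rightarrow> 'w set set \<Rightarrow> bool" where
  "simplicial_iso f K L \<longleftrightarrow> bij_betw f (\<Union>K) (\<Union>L) \<and> (image f) ` K = L"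

definition link :: "'v set set \<Rightarrow> 'v \<Rightarrow> 'v set set" where
  "link K v = {\<tau>. \<tau> \<noteq> {} \<and> v \<notin> \<tau> \<and> insert v \<tau> \<in> K}"

definition closed_star :: "'v set set \<Rightarrow> 'v \<Rightarrow> 'v set set" where
  "closed_star K v = {\<sigma> \<in> K. \<exists>\<tau>\<in>K. v \<in> \<tau> \<and> \<sigma> \<subseteq> \<tau>}"

text \<open>The connected component (as a subcomplex) that contains the simplex \<open>\<sigma>\<close>; components are
  determined by edge paths.\<close>

definition component_of :: "'v set set \<Rightarrow> 'v set \<Rightarrow> 'v set set" where
  "component_of K \<sigma> = {\<tau> \<in> K. \<exists>u\<in>\<sigma>. \<exists>v\<in>\<tau>. (\<lambda>a b. {a, b} \<in> K)\<^sup>*\<^sup>* u v}"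

definition components :: "'v set set \<Rightarrow> 'v set set set" where
  "components K = component_of K ` K"


section \<open>Desingularization\<close>

text \<open>A vertex of the desingularization is a pair \<open>(v, C)\<close> of a vertex \<open>v\<close> and a component
  (a circle, in the case of interest) \<open>C\<close> of its link. For a simplex \<open>\<sigma>\<close> of positive dimension
  with vertex \<open>v\<close>, the face \<open>\<sigma> - {v}\<close> opposite to \<open>v\<close> lies in exactly one component of
  the link of \<open>v\<close>, so \<open>\<sigma>\<close> lifts to a unique simplex.\<close>

definition lift_vertex :: "'v set set \<Rightarrow> 'v set \<Rightarrow> 'v \<Rightarrow> 'v \<times> 'v set set" where
  "lift_vertex K \<sigma> v = (v, component_of (link K v) (\<sigma> - {v}))"

definition lift_simplex :: "'v set set \<Rightarrow> 'v set \<Rightarrow> ('v \<times> 'v set set) set" where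
  "lift_simplex K \<sigma> = lift_vertex K \<sigma> ` \<sigma>"

definition desingularization :: "'v set set \<Rightarrow> ('v \<times> 'v set set) set set" where
  "desingularization K =
     {{(v, C)} | v C. v \<in> \<Union>K \<and> C \<in> components (link K v)} \<union>
     {lift_simplex K \<sigma> | \<sigma>. \<sigma> \<in> K \<and> 2 \<le> card \<sigma>}"

text \<open>The action on the desingularization induced by a simplicial automorphism.\<close>

definition desingularization_map ::
    "('v \<Rightarrow> 'v) \<Rightarrow> 'v \<times> 'v set set \<Rightarrow> 'v \<times> 'v set set" where
  "desingularization_map f = (\<lambda>(v, C). (f v, (image f) ` C))"


section \<open>Polygons\<close>

definition polygon_edges :: "'v list \<Rightarrow> 'v set set" where
  "polygon_edges vs = {{vs ! i, vs ! (Suc i mod length vs)} | i. i < length vs}"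

text \<open>An \<open>n\<close>-gon given by its set of edges.\<close>

definition is_ngon :: "nat \<Rightarrow> 'v set set \<Rightarrow> bool" where
  "is_ngon n E \<longleftrightarrow>
     3 \<le> n \<and> (\<exists>vs. length vs = n \<and> distinct vs \<and> E = polygon_edges vs)"

text \<open>The disk obtained by coning an \<open>n\<close>-gon to a centre \<open>c\<close>.\<close>

definition is_coned_ngon :: "nat \<Rightarrow> 'v \<Rightarrow> 'v set set \<Rightarrow> bool" where
  "is_coned_ngon n c K \<longleftrightarrow>
     3 \<le> n \<and> (\<exists>vs. length vs = n \<and> distinct vs \<and> c \<notin> set vs \<and>
       K = {\<sigma>. \<sigma> \<noteq> {} \<and> (\<exists>e\<in>polygon_edges vs. \<sigma> \<subseteq> insert c e)})"


section \<open>The complexes \<open>X(G)\<close> and \<open>Y(G)\<close>\<close>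

datatype vertex_type = Type1 | Type2

type_synonym 'a xvertex = "'a \<times> vertex_type"
type_synonym 'a yvertex = "'a xvertex \<times> 'a xvertex set set"

definition group_center :: "('a, 'b) monoid_scheme \<Rightarrow> 'a set" where
  "group_center G = {z \<in> carrier G. \<forall>g\<in>carrier G. z \<otimes>\<^bsub>G\<^esub> g = g \<otimes>\<^bsub>G\<^esub> z}"

definition noncommuting :: "('a, 'b) monoid_scheme \<Rightarrow> 'a \<Rightarrow> 'a \<Rightarrow> bool" where
  "noncommuting G x y \<longleftrightarrow>
     x \<in> carrier G \<and> y \<in> carrier G \<and> x \<otimes>\<^bsub>G\<^esub> y \<noteq> y \<otimes>\<^bsub>G\<^esub> x"

definition X_triangle :: "('a, 'b) monoid_scheme \<Rightarrow> 'a \<Rightarrow> 'a \<Rightarrow> 'a xvertex set" where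
  "X_triangle G x y = {(x, Type1), (y, Type1), (x \<otimes>\<^bsub>G\<^esub> y, Type2)}"

definition X_complex :: "('a, 'b) monoid_scheme \<Rightarrow> 'a xvertex set set" where
  "X_complex G =
     {{(x, t)} | x t. x \<in> carrier G - group_center G} \<union>
     {{(x, Type1), (y, Type1)} | x y. noncommuting G x y} \<union>
     {{(x, Type1), (y, Type2)} | x y. noncommuting G x y} \<union>
     {X_triangle G x y | x y. noncommuting G x y}"

definition Y_complex :: "('a, 'b) monoid_scheme \<Rightarrow> 'a yvertex set set" where
  "Y_complex G = desingularization (X_complex G)"

definition Y_triangle :: "('a, 'b) monoid_scheme \<Rightarrow> 'a \<Rightarrow> 'a \<Rightarrow> 'a yvertex set" where
  "Y_triangle G x y = lift_simplex (X_complex G) (X_triangle G x y)"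

text \<open>The edge \<open>[(x,1),(y,1)]\<close>, oriented from \<open>(x,1)\<close> to \<open>(y,1)\<close>, as an edge of \<open>Y(G)\<close>.\<close>

definition Y_edge :: "('a, 'b) monoid_scheme \<Rightarrow> 'a \<Rightarrow> 'a \<Rightarrow> 'a yvertex \<times> 'a yvertex" where
  "Y_edge G x y =
     (let e = {(x, Type1), (y, Type1)}
      in (lift_vertex (X_complex G) e (x, Type1), lift_vertex (X_complex G) e (y, Type1)))"

definition label :: "'a yvertex \<Rightarrow> 'a" where
  "label v = fst (fst v)"

definition vtype :: "'a yvertex \<Rightarrow> vertex_type" where
  "vtype v = snd (fst v)"

definition conj_by :: "('a, 'b) monoid_scheme \<Rightarrow> 'a \<Rightarrow> 'a \<Rightarrow> 'a" where
  "conj_by G g a = g \<otimes>\<^bsub>G\<^esub> a \<otimes>\<^bsub>G\<^esub> inv\<^bsub>G\<^esub> g"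

definition X_conj :: "('a, 'b) monoid_scheme \<Rightarrow> 'a \<Rightarrow> 'a xvertex \<Rightarrow> 'a xvertex" where
  "X_conj G g = (\<lambda>(a, t). (conj_by G g a, t))"

definition Y_conj :: "('a, 'b) monoid_scheme \<Rightarrow> 'a \<Rightarrow> 'a yvertex \<Rightarrow> 'a yvertex" where
  "Y_conj G g = desingularization_map (X_conj G g)"


section \<open>The 2-cell structure on a component of \<open>Y(G)\<close>\<close>

definition cell_vertices :: "'a yvertex set set \<Rightarrow> 'a yvertex set" where
  "cell_vertices T = {v \<in> \<Union>T. vtype v = Type1}"

definition cell_edges :: "'a yvertex set set \<Rightarrow> 'a yvertex set set" where
  "cell_edges T = {e \<in> T. card e = 2 \<and> (\<forall>v\<in>e. vtype v = Type1)}"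

definition cell_oriented_edges :: "'a yvertex set set \<Rightarrow> ('a yvertex \<times> 'a yvertex) set" where
  "cell_oriented_edges T = {(u, v). {u, v} \<in> cell_edges T}"

definition type2_vertices :: "'a yvertex set set \<Rightarrow> 'a yvertex set" where
  "type2_vertices T = {w \<in> \<Union>T. vtype w = Type2}"

text \<open>A face is a sheet about a type 2 vertex. Faces are not identified with their boundaries,
  since two distinct faces may have the same boundary.\<close>

definition cell_faces :: "'a yvertex set set \<Rightarrow> 'a yvertex set set set" where
  "cell_faces T = closed_star T ` type2_vertices T"

definition face_boundary :: "'a yvertex set set \<Rightarrow> 'a yvertex set set" where
  "face_boundary F = cell_edges F"

definition valency :: "'a yvertex set set \<Rightarrow> 'a yvertex \<Rightarrow> nat" where
  "valency T v = card {e \<in> cell_edges T. v \<in> e}"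

definition cell_automorphism_group ::
    "'a yvertex set set \<Rightarrow> ('a yvertex \<Rightarrow> 'a yvertex) monoid" where
  "cell_automorphism_group T = (BijGroup (cell_vertices T))
     \<lparr>carrier := {f \<in> Bij (cell_vertices T).
        (image f) ` cell_edges T = cell_edges T \<and>
        (\<lambda>F. (image f) ` face_boundary F) ` cell_faces T = face_boundary ` cell_faces T}\<rparr>"

definition edge_transitive :: "'a yvertex set set \<Rightarrow> bool" where
  "edge_transitive T \<longleftrightarrow>
     (\<forall>e\<in>cell_edges T. \<forall>e'\<in>cell_edges T.
        \<exists>f\<in>carrier (cell_automorphism_group T). f ` e = e')"

definition face_transitive :: "'a yvertex set set \<Rightarrow> bool" where
  "face_transitive T \<longleftrightarrow>
     (\<forall>F\<in>cell_faces T. \<forall>F'\<in>cell_faces T.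
        \<exists>f\<in>carrier (cell_automorphism_group T). (image f) ` face_boundary F = face_boundary F')"


section \<open>Every simplex of \<open>Y(G)\<close> lies in a unique component\<close>

lemma simplicial_complex_face:
  assumes "simplicial_complex K" and "\<sigma> \<in> K" and "\<tau> \<subseteq> \<sigma>" and "\<tau> \<noteq> {}"
  shows "\<tau> \<in> K"
  using assms(1)[unfolded simplicial_complex_def, rule_format, OF assms(2)] assms(3,4) by simp

lemma simplicial_complex_simplex:
  assumes "simplicial_complex K" and "\<sigma> \<in> K"
  shows "finite \<sigma>" "\<sigma> \<noteq> {}"
  using assms(1)[unfolded simplicial_complex_def, rule_format, OF assms(2)] by simp_all

lemma simplicial_complexI:
  assumes "\<And>\<sigma>. \<sigma> \<in> K \<Longrightarrow> finite \<sigma>" and "\<And>\<sigma>. \<sigma> \<in> K \<Longrightarrow> \<sigma> \<noteq> {}"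
    and "\<And>\<sigma> \<tau>. \<sigma> \<in> K \<Longrightarrow> \<tau> \<subseteq> \<sigma> \<Longrightarrow> \<tau> \<noteq> {} \<Longrightarrow> \<tau> \<in> K"
  shows "simplicial_complex K"
  unfolding simplicial_complex_def
proof (intro ballI conjI allI impI)
  fix \<sigma> \<tau> assume "\<sigma> \<in> K" "\<tau> \<noteq> {} \<and> \<tau> \<subseteq> \<sigma>"
  then show "\<tau> \<in> K" using assms(3)[of \<sigma> \<tau>] by simp
qed (use assms(1,2) in blast)+

lemma component_of_eqI:
  assumes K: "simplicial_complex K" and s: "\<sigma> \<in> K" and t: "\<tau> \<in> component_of K \<sigma>"
  shows "component_of K \<tau> = component_of K \<sigma>"
proof -
  define S where S: "S = (\<lambda>a b. {a, b} \<in> K)\<^sup>*\<^sup>*"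
  have tr: "S a c" if "S a b" "S b c" for a b c
    using that unfolding S by (rule rtranclp_trans)
  have "symp (\<lambda>a b. {a, b} \<in> K)"
    by (simp add: symp_def insert_commute)
  then have "symp S" unfolding S by (rule symp_rtranclp)
  then have sy: "S b a" if "S a b" for a b using that by (rule sympD)
  have ins: "S a b" if "\<rho> \<in> K" "a \<in> \<rho>" "b \<in> \<rho>" for \<rho> a b
  proof -
    have "{a, b} \<subseteq> \<rho>" "{a, b} \<noteq> {}" using that by simp_all
    then have "{a, b} \<in> K" by (rule simplicial_complex_face[OF K that(1)])
    then show ?thesis unfolding S by (rule r_into_rtranclp)
  qed
  from t obtain u v where tK: "\<tau> \<in> K" and uv: "u \<in> \<sigma>" "v \<in> \<tau>" "S u v"
    unfolding component_of_def S[symmetric] by blast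
  have 1: "S a b" if "a \<in> \<sigma>" "b \<in> \<tau>" for a b
    by (rule tr[OF tr[OF ins[OF s that(1) uv(1)] uv(3)] ins[OF tK uv(2) that(2)]])
  have mem: "\<rho> \<in> component_of K \<xi> \<longleftrightarrow> \<rho> \<in> K \<and> (\<exists>a\<in>\<xi>. \<exists>c\<in>\<rho>. S a c)" for \<rho> \<xi>
    unfolding component_of_def S[symmetric] by (rule mem_Collect_eq)
  show ?thesis
  proof (rule equalityI; rule subsetI)
    fix \<rho> assume "\<rho> \<in> component_of K \<tau>"
    then obtain a c where *: "\<rho> \<in> K" "a \<in> \<tau>" "c \<in> \<rho>" "S a c" unfolding mem by blast
    then have "S u c" using tr[OF 1[OF uv(1)]] by simp
    then show "\<rho> \<in> component_of K \<sigma>" unfolding mem using * uv(1) by blast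
  next
    fix \<rho> assume "\<rho> \<in> component_of K \<sigma>"
    then obtain a c where *: "\<rho> \<in> K" "a \<in> \<sigma>" "c \<in> \<rho>" "S a c" unfolding mem by blast
    then have "S v c" using tr[OF sy[OF 1[OF _ uv(2)]]] by simp
    then show "\<rho> \<in> component_of K \<tau>" unfolding mem using * uv(2) by blast
  qed
qed

lemma component_of_self:
  assumes "simplicial_complex K" and "\<sigma> \<in> K"
  shows "\<sigma> \<in> component_of K \<sigma>"
proof -
  obtain u where "u \<in> \<sigma>" using simplicial_complex_simplex(2)[OF assms] by blast
  then show ?thesis unfolding component_of_def using assms(2) by blast
qed

lemma ex1_component:
  assumes "simplicial_complex K" and "\<sigma> \<in> K"
  shows "\<exists>!T. T \<in> components K \<and> \<sigma> \<in> T"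
proof (rule ex1I[of _ "component_of K \<sigma>"])
  show "component_of K \<sigma> \<in> components K \<and> \<sigma> \<in> component_of K \<sigma>"
    using component_of_self[OF assms] assms(2) by (simp add: components_def)
  fix T assume T: "T \<in> components K \<and> \<sigma> \<in> T"
  then obtain \<rho> where "\<rho> \<in> K" "T = component_of K \<rho>" by (auto simp: components_def)
  then show "T = component_of K \<sigma>" using component_of_eqI[OF assms(1)] T by simp
qed

lemma simplicial_complex_link:
  assumes K: "simplicial_complex K"
  shows "simplicial_complex (link K v)"
proof -
  have 1: "\<tau> \<in> link K v" if "\<sigma> \<in> link K v" "\<tau> \<subseteq> \<sigma>" "\<tau> \<noteq> {}" for \<sigma> \<tau>
  proof -
    have "insert v \<sigma> \<in> K" "v \<notin> \<sigma>" using that(1) by (simp_all add: link_def)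
    moreover have "insert v \<tau> \<in> K"
      by (rule simplicial_complex_face[OF K \<open>insert v \<sigma> \<in> K\<close>]) (use that(2) in auto)
    ultimately show ?thesis using that(2,3) by (auto simp: link_def)
  qed
  have 2: "finite \<sigma>" "\<sigma> \<noteq> {}" if "\<sigma> \<in> link K v" for \<sigma>
    using that simplicial_complex_simplex(1)[OF K, of "insert v \<sigma>"] by (simp_all add: link_def)
  show ?thesis by (rule simplicial_complexI[OF 2 1])
qed

lemma lift_vertex_face:
  assumes K: "simplicial_complex K" and s: "\<sigma> \<in> K" and "\<rho> \<subseteq> \<sigma>" "v \<in> \<rho>" "\<rho> \<noteq> {v}"
  shows "lift_vertex K \<rho> v = lift_vertex K \<sigma> v"
proof -
  have L: "simplicial_complex (link K v)" using K by (rule simplicial_complex_link)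
  have r: "\<rho> \<in> K" by (rule simplicial_complex_face[OF K s assms(3)]) (use assms(4) in blast)
  have mem: "\<xi> - {v} \<in> link K v" if "\<xi> \<in> K" "v \<in> \<xi>" "\<xi> \<noteq> {v}" for \<xi>
  proof -
    have "insert v (\<xi> - {v}) = \<xi>" using that(2) by blast
    moreover have "\<xi> - {v} \<noteq> {}" using that(2,3) by blast
    ultimately show ?thesis using that(1) by (simp add: link_def)
  qed
  have 1: "\<sigma> - {v} \<in> link K v" by (rule mem[OF s]) (use assms(3-5) in blast)+
  have 2: "\<rho> - {v} \<in> link K v" by (rule mem[OF r assms(4,5)])
  obtain u where "u \<in> \<rho> - {v}" using assms(4,5) by blast
  moreover have "u \<in> \<sigma> - {v}" using calculation assms(3) by blast
  ultimately have "\<rho> - {v} \<in> component_of (link K v) (\<sigma> - {v})"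
    unfolding component_of_def using 2 by blast
  from component_of_eqI[OF L 1 this] show ?thesis by (simp add: lift_vertex_def)
qed

lemma simplicial_complex_desingularization:
  assumes K: "simplicial_complex K"
  shows "simplicial_complex (desingularization K)"
proof -
  have fin: "finite \<sigma>" if "\<sigma> \<in> K" for \<sigma> by (rule simplicial_complex_simplex(1)[OF K that])
  have sub: "\<tau> \<in> desingularization K"
    if s: "\<sigma> \<in> K" "2 \<le> card \<sigma>" and t: "\<tau> \<noteq> {}" "\<tau> \<subseteq> lift_simplex K \<sigma>" for \<sigma> \<tau>
  proof -
    obtain \<rho> where r: "\<rho> \<subseteq> \<sigma>" "\<tau> = lift_vertex K \<sigma> ` \<rho>"
      using t(2) unfolding lift_simplex_def by (meson subset_imageE)
    have rK: "\<rho> \<in> K" by (rule simplicial_complex_face[OF K s(1) r(1)]) (use r t(1) in auto)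
    show ?thesis
    proof (cases "\<exists>v. \<rho> = {v}")
      case True
      then obtain v where v: "\<rho> = {v}" by blast
      have "\<sigma> \<noteq> {v}" using s(2) by auto
      moreover have "v \<in> \<sigma>" using r(1) v by blast
      ultimately have "insert v (\<sigma> - {v}) = \<sigma>" "\<sigma> - {v} \<noteq> {}" by blast+
      then have "\<sigma> - {v} \<in> link K v" using s(1) by (simp add: link_def)
      then have "component_of (link K v) (\<sigma> - {v}) \<in> components (link K v)"
        unfolding components_def by (rule imageI)
      moreover have "v \<in> \<Union>K" using s(1) \<open>v \<in> \<sigma>\<close> by (rule UnionI)
      moreover have "\<tau> = {(v, component_of (link K v) (\<sigma> - {v}))}"
        using r(2) v by (simp add: lift_vertex_def)
      ultimately show ?thesis unfolding desingularization_def by blast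
    next
      case False
      have "card \<rho> \<noteq> 0" "card \<rho> \<noteq> 1"
        using False fin[OF rK] t(1) r(2) by (auto simp: card_1_singleton_iff)
      then have "2 \<le> card \<rho>" by linarith
      moreover have "\<tau> = lift_simplex K \<rho>"
        unfolding lift_simplex_def r(2)
      proof (rule image_cong[OF refl])
        fix v assume "v \<in> \<rho>"
        then show "lift_vertex K \<sigma> v = lift_vertex K \<rho> v"
          using lift_vertex_face[OF K s(1) r(1)] False by simp
      qed
      ultimately show ?thesis unfolding desingularization_def using rK by blast
    qed
  qed
  have cases: "(\<exists>p. \<sigma> = {p}) \<or> (\<exists>\<rho>. \<rho> \<in> K \<and> 2 \<le> card \<rho> \<and> \<sigma> = lift_simplex K \<rho>)"
    if "\<sigma> \<in> desingularization K" for \<sigma>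
    using that unfolding desingularization_def by blast
  show ?thesis
  proof (rule simplicial_complexI)
    fix \<sigma> assume "\<sigma> \<in> desingularization K"
    from cases[OF this] show "finite \<sigma>" by (elim disjE exE conjE) (simp_all add: lift_simplex_def fin)
  next
    fix \<sigma> assume "\<sigma> \<in> desingularization K"
    from cases[OF this] show "\<sigma> \<noteq> {}" by (elim disjE exE conjE) (auto simp: lift_simplex_def)
  next
    fix \<sigma> \<tau> assume s: "\<sigma> \<in> desingularization K" and t: "\<tau> \<subseteq> \<sigma>" "\<tau> \<noteq> {}"
    from cases[OF s] show "\<tau> \<in> desingularization K"
    proof (elim disjE exE conjE)
      fix p assume "\<sigma> = {p}"
      then have "\<tau> = \<sigma>" using t by blast
      then show ?thesis using s by (simp only:)
    next
      fix \<rho> assume "\<rho> \<in> K" "2 \<le> card \<rho>" "\<sigma> = lift_simplex K \<rho>"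
      then show ?thesis using sub[of \<rho> \<tau>] t by simp
    qed
  qed
qed

lemma (in group) noncommuting_mult:
  assumes "noncommuting G x y"
  shows "noncommuting G y x" "noncommuting G x (x \<otimes> y)" "noncommuting G y (x \<otimes> y)"
proof -
  have c: "x \<in> carrier G" "y \<in> carrier G" "x \<otimes> y \<noteq> y \<otimes> x"
    using assms by (auto simp: noncommuting_def)
  show "noncommuting G y x" using c by (auto simp: noncommuting_def)
  show "noncommuting G x (x \<otimes> y)" using c by (auto simp: noncommuting_def m_assoc)
  show "noncommuting G y (x \<otimes> y)"
    using c by (auto simp: noncommuting_def simp flip: m_assoc)
qed

lemma noncommuting_not_central:
  assumes "noncommuting G x y"
  shows "x \<in> carrier G - group_center G" "y \<in> carrier G - group_center G"
  using assms by (force simp: noncommuting_def group_center_def)+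

lemma (in group) simplicial_complex_X: "simplicial_complex (X_complex G)"
proof -
  have two: "\<tau> = {a} \<or> \<tau> = {b} \<or> \<tau> = {a, b}" if "\<tau> \<noteq> {}" "\<tau> \<subseteq> {a, b}"
    for \<tau> :: "'a xvertex set" and a b
    using that by blast
  have three: "\<tau> = {a} \<or> \<tau> = {b} \<or> \<tau> = {c} \<or> \<tau> = {a, b} \<or> \<tau> = {a, c} \<or> \<tau> = {b, c} \<or> \<tau> = {a, b, c}"
    if "\<tau> \<noteq> {}" "\<tau> \<subseteq> {a, b, c}" for \<tau> :: "'a xvertex set" and a b c
    using that by blast
  have v: "{(x, t)} \<in> X_complex G" if "x \<in> carrier G - group_center G" for x t
    using that unfolding X_complex_def by blast
  have e1: "{(x, Type1), (y, Type1)} \<in> X_complex G"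
    and e2: "{(x, Type1), (y, Type2)} \<in> X_complex G"
    and f: "X_triangle G x y \<in> X_complex G"
    if "noncommuting G x y" for x y
    using that unfolding X_complex_def by blast+
  show ?thesis
  proof (rule simplicial_complexI)
    show "finite \<sigma>" "\<sigma> \<noteq> {}" if "\<sigma> \<in> X_complex G" for \<sigma>
      using that by (auto simp: X_complex_def X_triangle_def)
  next
    fix \<sigma> \<tau> assume s: "\<sigma> \<in> X_complex G" and tau: "\<tau> \<subseteq> \<sigma>" "\<tau> \<noteq> {}"
    from s consider (v) x t where "\<sigma> = {(x, t)}"
      | (e) x y t where "\<sigma> = {(x, Type1), (y, t)}" "noncommuting G x y"
      | (f) x y where "\<sigma> = X_triangle G x y" "noncommuting G x y"
      unfolding X_complex_def by blast
    then show "\<tau> \<in> X_complex G"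
    proof cases
      case v
      then have "\<tau> = \<sigma>" using tau by blast
      then show ?thesis using s by simp
    next
      case (e x y t)
      have "\<tau> = {(x, Type1)} \<or> \<tau> = {(y, t)} \<or> \<tau> = \<sigma>"
        using two[of \<tau> "(x, Type1)" "(y, t)"] tau e(1) by simp
      then show ?thesis using s v noncommuting_not_central[OF e(2)] by (elim disjE) simp_all
    next
      case (f x y)
      note n = noncommuting_mult[OF f(2)]
      have "\<tau> = {(x, Type1)} \<or> \<tau> = {(y, Type1)} \<or> \<tau> = {(x \<otimes> y, Type2)}
          \<or> \<tau> = {(x, Type1), (y, Type1)} \<or> \<tau> = {(x, Type1), (x \<otimes> y, Type2)}
          \<or> \<tau> = {(y, Type1), (x \<otimes> y, Type2)} \<or> \<tau> = \<sigma>"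
        using three[of \<tau> "(x, Type1)" "(y, Type1)" "(x \<otimes> y, Type2)"] tau f(1)
        unfolding X_triangle_def by simp
      then show ?thesis
        using s v noncommuting_not_central[OF f(2)] noncommuting_not_central[OF n(2)]
          e1[OF f(2)] e2[OF n(2)] e2[OF n(3)] by (elim disjE) simp_all
    qed
  qed
qed

lemma (in group) ex1_component_Y:
  assumes "noncommuting G x y"
  shows "\<exists>!T. T \<in> components (Y_complex G) \<and> Y_triangle G x y \<in> T"
proof (rule ex1_component)
  show "simplicial_complex (Y_complex G)"
    unfolding Y_complex_def
    by (intro simplicial_complex_desingularization simplicial_complex_X)
  have "x \<noteq> y" using assms by (auto simp: noncommuting_def)
  then have "2 \<le> card (X_triangle G x y)" by (simp add: X_triangle_def)
  moreover have "X_triangle G x y \<in> X_complex G"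
    using assms unfolding X_complex_def by blast
  ultimately show "Y_triangle G x y \<in> Y_complex G"
    unfolding Y_complex_def Y_triangle_def desingularization_def by blast
qed

end

theory Submission
  imports Defs "HOL-Algebra.Multiplicative_Group"
begin

text \<open>Walking around the sheet about \<open>(c, Type2)\<close> replaces a type 1 vertex \<open>a\<close> by \<open>a\<^sup>-\<^sup>1c\<close>, that is, a
  triangle \<open>(a, b)\<close> with \<open>ab = c\<close> by \<open>(b, b\<^sup>-\<^sup>1ab)\<close>; two such steps are conjugation by \<open>c\<^sup>-\<^sup>1\<close>. Crossing the
  edge between the two type 1 vertices replaces \<open>(a, b)\<close> by \<open>(b, a)\<close>, which is the conjugate by \<open>b\<close> of
  \<open>(b, b\<^sup>-\<^sup>1ab)\<close>. Hence the triangles in the component of \<open>(x, y)\<close> are conjugates of \<open>(x, y)\<close> and of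
  \<open>(y, y\<^sup>-\<^sup>1xy)\<close> by elements of \<open>\<langle>x, y\<rangle>\<close>. The latter triangle lies in the same sheet as the former, so all
  sheets are conjugate; and a conjugation that carries some point of the component into the component
  preserves it, which gives the automorphisms.\<close>

section \<open>Simplicial isomorphisms\<close>

text \<open>A vertex of \<open>Y(G)\<close> is a vertex of \<open>X(G)\<close> together with a
  component of its link, so whether two triangles share a vertex is a question about edge paths in a
  link. Each kind of vertex gets an invariant of such paths. At \<open>(a, Type1)\<close> the
  partner of \<open>a\<close> changes only by conjugation with \<open>a\<close> or its inverse; at
  \<open>(c, Type2)\<close> the label moves along the iterates of
  \<open>z \<mapsto> inv z \<otimes> c\<close>. An edge path may run backwards, and finiteness of
  the group turns a backward step into forward ones; it also makes the sheet close up.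

  The subgroup generated by \<open>x\<close> and \<open>y\<close> suffices because every conjugating
  element that occurs is an entry of the current pair, or the inverse of one, and these entries
  never leave the subgroup.

  Two base pairs are kept because the reversal of an oriented edge is conjugate to the other base
  pair and need not be conjugate to the edge itself. On sheets and on unoriented edges the
  difference disappears.\<close>

lemma simplicial_isoD:
  assumes "simplicial_iso f K L"
  shows "inj_on f (\<Union>K)" "f ` \<Union>K = \<Union>L" "(image f) ` K = L" "s \<in> K \<Longrightarrow> f ` s \<in> L"
  using assms by (auto simp: simplicial_iso_def bij_betw_def)

lemma simplicial_iso_mem_iff:
  assumes "simplicial_iso f K L" and "s \<in> K" and "v \<in> \<Union>K"
  shows "f v \<in> f ` s \<longleftrightarrow> v \<in> s"
  by (rule inj_on_image_mem_iff[OF simplicial_isoD(1)[OF assms(1)] assms(3)])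
    (use assms(2) in blast)

lemma simplicial_iso_image_remove:
  assumes "simplicial_iso f K L" and "s \<in> K" and "v \<in> s"
  shows "f ` (s - {v}) = f ` s - {f v}"
proof -
  have "s - {v} \<subseteq> \<Union>K" "{v} \<subseteq> \<Union>K" using assms(2,3) by blast+
  then have "f ` (s - {v}) = f ` s - f ` {v}"
    using inj_on_image_set_diff[OF simplicial_isoD(1)[OF assms(1)]] by blast
  then show ?thesis by simp
qed

lemma simplicial_isoI:
  assumes "inj_on f (\<Union>K)" and "(image f) ` K = L"
  shows "simplicial_iso f K L"
  using assms by (auto simp: simplicial_iso_def bij_betw_def)

lemma simplicial_isoI_inverse:
  assumes f: "\<And>s. s \<in> K \<Longrightarrow> f ` s \<in> L" and g: "\<And>s. s \<in> L \<Longrightarrow> g ` s \<in> K"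
    and gf: "\<And>v. v \<in> \<Union>K \<Longrightarrow> g (f v) = v" and fg: "\<And>v. v \<in> \<Union>L \<Longrightarrow> f (g v) = v"
  shows "simplicial_iso f K L"
proof (rule simplicial_isoI)
  show "inj_on f (\<Union>K)" using gf by (rule inj_on_inverseI)
  show "(image f) ` K = L"
  proof
    show "(image f) ` K \<subseteq> L" using f by blast
    show "L \<subseteq> (image f) ` K"
    proof
      fix s assume s: "s \<in> L"
      have "f ` g ` s = s" using fg s by (force simp: image_image)
      then show "s \<in> (image f) ` K" using g[OF s] by (metis imageI)
    qed
  qed
qed

text \<open>Vertices of the desingularization carry a link component as second coordinate, so an
  automorphism acts on them only through its action on links.\<close>

lemma simplicial_iso_link:
  assumes f: "simplicial_iso f K L" and v: "v \<in> \<Union>K"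
  shows "simplicial_iso f (link K v) (link L (f v))"
proof -
  note inj = simplicial_isoD(1)[OF f]
  have sub: "\<Union>(link K v) \<subseteq> \<Union>K" by (auto simp: link_def)
  show ?thesis
  proof (rule simplicial_isoI)
    show "inj_on f (\<Union>(link K v))" using inj sub by (rule inj_on_subset)
    show "(image f) ` link K v = link L (f v)"
    proof (intro equalityI subsetI)
      fix t assume "t \<in> (image f) ` link K v"
      then obtain s where s: "t = f ` s" "s \<noteq> {}" "v \<notin> s" "insert v s \<in> K"
        by (auto simp: link_def)
      have "s \<subseteq> \<Union>K" using s(4) by blast
      then have "f v \<notin> f ` s" using s(3) inj_on_image_mem_iff[OF inj v] by simp
      moreover have "insert (f v) (f ` s) \<in> L" using simplicial_isoD(4)[OF f s(4)] by simp
      ultimately show "t \<in> link L (f v)" using s by (simp add: link_def)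
    next
      fix t assume t: "t \<in> link L (f v)"
      then obtain s where s: "s \<in> K" "insert (f v) t = f ` s"
        using simplicial_isoD(3)[OF f] by (auto simp: link_def)
      have "f v \<in> f ` s" using s(2) by blast
      then have vs: "v \<in> s" using simplicial_iso_mem_iff[OF f s(1) v] by simp
      have "f ` (s - {v}) = f ` s - {f v}"
        by (rule simplicial_iso_image_remove[OF f s(1) vs])
      also have "\<dots> = t" using t s(2) by (auto simp: link_def)
      finally have ft: "f ` (s - {v}) = t" .
      moreover have "s - {v} \<noteq> {}" using ft t by (auto simp: link_def)
      then have "s - {v} \<in> link K v" using s(1) vs by (simp add: link_def insert_absorb)
      ultimately show "t \<in> (image f) ` link K v" by blast
    qed
  qed
qed

text \<open>Edge paths are pushed forward and pulled back. The assumption is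
  \<open>t \<subseteq> \<Union>K\<close> and not \<open>t \<in> K\<close> so that the empty set is
  covered, which arises as \<open>s - {v}\<close> for \<open>s = {v}\<close>.\<close>

lemma simplicial_iso_component_of:
  assumes f: "simplicial_iso f K L" and t: "t \<subseteq> \<Union>K"
  shows "(image f) ` component_of K t = component_of L (f ` t)"
proof -
  note inj = simplicial_isoD(1)[OF f]
  have fwd: "(\<lambda>a b. {a, b} \<in> L)\<^sup>*\<^sup>* (f u) (f v)" if "(\<lambda>a b. {a, b} \<in> K)\<^sup>*\<^sup>* u v" for u v
    using that
  proof induction
    case (step v w)
    have "{f v, f w} \<in> L" using simplicial_isoD(4)[OF f step(2)] by simp
    with step.IH show ?case by (rule rtranclp.rtrancl_into_rtrancl)
  qed simp
  \<comment> \<open>A path in \<open>L\<close> is lifted edge by edge: the edge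
    \<open>{f v, z}\<close> is the image of some simplex \<open>s\<close>, and injectivity forces
    \<open>s = {v, w}\<close> with \<open>f w = z\<close>. The degenerate edge
    \<open>z = f v\<close> is included.\<close>
  have bwd: "\<exists>v\<in>\<Union>K. z = f v \<and> (\<lambda>a b. {a, b} \<in> K)\<^sup>*\<^sup>* u v"
    if "(\<lambda>a b. {a, b} \<in> L)\<^sup>*\<^sup>* (f u) z" "u \<in> \<Union>K" for u z
    using that
  proof induction
    case base then show ?case by blast
  next
    case (step y z)
    then obtain v where v: "v \<in> \<Union>K" "y = f v" "(\<lambda>a b. {a, b} \<in> K)\<^sup>*\<^sup>* u v" by blast
    obtain s where s: "s \<in> K" "{f v, z} = f ` s"
      using step(2) simplicial_isoD(3)[OF f] v(2) by auto
    have "z \<in> f ` s" "f v \<in> f ` s" using s(2) by blast+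
    then obtain w where w: "w \<in> s" "z = f w" and "v \<in> s"
      using simplicial_iso_mem_iff[OF f s(1) v(1)] by blast
    moreover have "s \<subseteq> {v, w}"
    proof
      fix q assume q: "q \<in> s"
      then have "f q = f v \<or> f q = f w" using s(2) w(2) by blast
      moreover have "q \<in> \<Union>K" "w \<in> \<Union>K" using q w(1) s(1) by blast+
      ultimately show "q \<in> {v, w}" using v(1) inj_onD[OF inj] by blast
    qed
    ultimately have "{v, w} \<in> K" using s(1) by (metis empty_subsetI insert_subset subset_antisym)
    with v(3) have "(\<lambda>a b. {a, b} \<in> K)\<^sup>*\<^sup>* u w" by (rule rtranclp.rtrancl_into_rtrancl)
    then show ?case using w s(1) by blast
  qed
  show ?thesis
  proof (intro equalityI subsetI)
    fix r assume "r \<in> (image f) ` component_of K t"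
    then obtain s u v where "r = f ` s" "s \<in> K" "u \<in> t" "v \<in> s" "(\<lambda>a b. {a, b} \<in> K)\<^sup>*\<^sup>* u v"
      by (auto simp: component_of_def)
    then show "r \<in> component_of L (f ` t)"
      using fwd simplicial_isoD(4)[OF f] by (auto simp: component_of_def)
  next
    fix r assume "r \<in> component_of L (f ` t)"
    then obtain u z where *: "r \<in> L" "u \<in> t" "z \<in> r" "(\<lambda>a b. {a, b} \<in> L)\<^sup>*\<^sup>* (f u) z"
      by (auto simp: component_of_def)
    then obtain v where v: "v \<in> \<Union>K" "z = f v" "(\<lambda>a b. {a, b} \<in> K)\<^sup>*\<^sup>* u v"
      using bwd t by blast
    obtain s where s: "s \<in> K" "r = f ` s" using *(1) simplicial_isoD(3)[OF f] by blast
    have "v \<in> s" using s v(1,2) *(3) simplicial_iso_mem_iff[OF f] by simp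
    then have "s \<in> component_of K t" using s(1) *(2) v(3) by (auto simp: component_of_def)
    then show "r \<in> (image f) ` component_of K t" using s(2) by blast
  qed
qed

lemma simplicial_iso_closed_star:
  assumes f: "simplicial_iso f K L" and v: "v \<in> \<Union>K"
  shows "(image f) ` closed_star K v = closed_star L (f v)"
proof (intro equalityI subsetI)
  fix r assume "r \<in> (image f) ` closed_star K v"
  then obtain s t where "r = f ` s" "s \<in> K" "t \<in> K" "v \<in> t" "s \<subseteq> t"
    by (auto simp: closed_star_def)
  then show "r \<in> closed_star L (f v)"
    using simplicial_isoD(4)[OF f] by (auto simp: closed_star_def)
next
  fix r assume "r \<in> closed_star L (f v)"
  then obtain s t where st: "s \<in> K" "t \<in> K" "r = f ` s" "f v \<in> f ` t" "f ` s \<subseteq> f ` t"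
    using simplicial_isoD(3)[OF f] by (force simp: closed_star_def)
  have "v \<in> t" using st(2,4) simplicial_iso_mem_iff[OF f _ v] by simp
  moreover have "s \<subseteq> t"
    using st(1,5) simplicial_iso_mem_iff[OF f st(2)] by blast
  ultimately
  show "r \<in> (image f) ` closed_star K v" using st by (auto simp: closed_star_def)
qed

lemma simplicial_iso_restrict_closed_star:
  assumes f: "simplicial_iso f K L" and v: "v \<in> \<Union>K"
  shows "simplicial_iso f (closed_star K v) (closed_star L (f v))"
proof (rule simplicial_isoI[OF inj_on_subset[OF simplicial_isoD(1)[OF f]]
    simplicial_iso_closed_star[OF assms]])
  show "\<Union>(closed_star K v) \<subseteq> \<Union>K" by (auto simp: closed_star_def)
qed

text \<open>Naturality of the lift: conjugation on \<open>Y(G)\<close> can be computed on a simplex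
  representing a vertex, without looking at link components.\<close>

lemma desingularization_map_lift_vertex:
  assumes f: "simplicial_iso f K L" and s: "s \<in> K" "v \<in> s"
  shows "desingularization_map f (lift_vertex K s v) = lift_vertex L (f ` s) (f v)"
proof -
  have v: "v \<in> \<Union>K" using s by blast
  have "s - {v} \<in> link K v" if "s - {v} \<noteq> {}"
    using s that by (simp add: link_def insert_absorb)
  then have "s - {v} \<subseteq> \<Union>(link K v)" by blast
  from simplicial_iso_component_of[OF simplicial_iso_link[OF f v] this]
  have "(image f) ` component_of (link K v) (s - {v}) = component_of (link L (f v)) (f ` (s - {v}))" .
  moreover have "f ` (s - {v}) = f ` s - {f v}"
    by (rule simplicial_iso_image_remove[OF f s])
  ultimately show ?thesis by (simp add: desingularization_map_def lift_vertex_def)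
qed

lemma component_of_meets:
  assumes K: "simplicial_complex K" and t: "t \<in> component_of K s"
    and r: "r \<in> K" "v \<in> t" "v \<in> r"
  shows "r \<in> component_of K s"
proof -
  obtain a b where ab: "t \<in> K" "a \<in> s" "b \<in> t" "(\<lambda>a b. {a, b} \<in> K)\<^sup>*\<^sup>* a b"
    using t by (auto simp: component_of_def)
  have "{b, v} \<in> K" by (rule simplicial_complex_face[OF K ab(1)]) (use ab(3) r(2) in simp_all)
  with ab(4) have "(\<lambda>a b. {a, b} \<in> K)\<^sup>*\<^sup>* a v" by (rule rtranclp.rtrancl_into_rtrancl)
  then show ?thesis using ab(2) r unfolding component_of_def by blast
qed

text \<open>A simplex meeting a component lies in it, so nothing of the star is lost. This
  reconciles faces, defined by stars in \<open>T\<close>, with sheets, which are stars in the whole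
  of \<open>Y(G)\<close>.\<close>

lemma closed_star_component_of:
  assumes K: "simplicial_complex K" and v: "v \<in> \<Union>(component_of K s)"
  shows "closed_star (component_of K s) v = closed_star K v"
proof -
  have sub: "component_of K s \<subseteq> K" by (auto simp: component_of_def)
  have "r \<in> component_of K s \<and> q \<in> component_of K s"
    if "r \<in> K" "v \<in> r" "q \<in> K" "q \<subseteq> r" for r q
  proof -
    have "r \<in> component_of K s" using v that component_of_meets[OF K] by blast
    moreover have "q \<noteq> {}" using simplicial_complex_simplex(2)[OF K that(3)] .
    ultimately show ?thesis using that component_of_meets[OF K, of r s q] by blast
  qed
  then show ?thesis using sub by (auto simp: closed_star_def)
qed

section \<open>Cones and cell structures\<close>

text \<open>The centre has type 2, so a type 1 edge of the cone avoids it and lies in a polygon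
  edge; equal cardinality then gives equality. With at least two vertices, no polygon edge
  degenerates to a point.\<close>

lemma cell_edges_cone:
  assumes n: "2 \<le> length vs" and d: "distinct vs"
    and c: "vtype c = Type2" and vs: "\<And>v. v \<in> set vs \<Longrightarrow> vtype v = Type1"
  shows "cell_edges {s. s \<noteq> {} \<and> (\<exists>e\<in>polygon_edges vs. s \<subseteq> insert c e)} = polygon_edges vs"
proof -
  have e: "card e = 2 \<and> (\<forall>v\<in>e. vtype v = Type1)" if e: "e \<in> polygon_edges vs" for e
  proof -
    obtain i where i: "i < length vs" "e = {vs ! i, vs ! (Suc i mod length vs)}"
      using e by (auto simp: polygon_edges_def)
    have j: "Suc i mod length vs < length vs" by (rule mod_less_divisor) (use n in linarith)
    have "i \<noteq> Suc i mod length vs" using i(1) n by (auto simp: mod_Suc)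
    then have "vs ! i \<noteq> vs ! (Suc i mod length vs)" using i j d by (simp add: nth_eq_iff_index_eq)
    then show ?thesis using i j vs by auto
  qed
  show ?thesis
  proof (intro equalityI subsetI)
    fix s assume "s \<in> cell_edges {s. s \<noteq> {} \<and> (\<exists>e\<in>polygon_edges vs. s \<subseteq> insert c e)}"
    then obtain e' where s: "card s = 2" "\<forall>v\<in>s. vtype v = Type1" "e' \<in> polygon_edges vs"
      "s \<subseteq> insert c e'" by (auto simp: cell_edges_def)
    have "s \<subseteq> e'" using s(2,4) c by auto
    moreover have "finite e'" "card e' \<le> card s" using e[OF s(3)] s(1) by (auto intro: card_ge_0_finite)
    ultimately have "s = e'" by (metis card_seteq)
    then show "s \<in> polygon_edges vs" using s(3) by simp
  next
    fix s assume "s \<in> polygon_edges vs"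
    then show "s \<in> cell_edges {s. s \<noteq> {} \<and> (\<exists>e\<in>polygon_edges vs. s \<subseteq> insert c e)}"
      using e[of s] by (auto simp: cell_edges_def)
  qed
qed

text \<open>Cell edges are singled out by cardinality and vertex types alone, both of which an
  injective type-preserving map respects.\<close>

lemma cell_edges_image:
  assumes "inj_on f (\<Union>K)" and "\<And>v. v \<in> \<Union>K \<Longrightarrow> vtype (f v) = vtype v"
  shows "cell_edges ((image f) ` K) = (image f) ` cell_edges K"
proof -
  have "(card (f ` s) = 2 \<and> (\<forall>v\<in>f ` s. vtype v = Type1))
      = (card s = 2 \<and> (\<forall>v\<in>s. vtype v = Type1))" if "s \<in> K" for s
  proof -
    have "s \<subseteq> \<Union>K" using that by blast
    then have "card (f ` s) = card s" and "\<And>v. v \<in> s \<Longrightarrow> vtype (f v) = vtype v"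
      using card_image[OF inj_on_subset[OF assms(1)]] assms(2) by blast+
    then show ?thesis by simp
  qed
  then have "{s \<in> K. card (f ` s) = 2 \<and> (\<forall>v\<in>f ` s. vtype v = Type1)} = cell_edges K"
    unfolding cell_edges_def by blast
  then show ?thesis unfolding cell_edges_def[of "(image f) ` K"] Compr_image_eq by (rule arg_cong)
qed

lemma cell_edges_in_vertices:
  assumes "e \<in> cell_edges T"
  shows "e \<subseteq> cell_vertices T" "e \<noteq> {}"
  using assms by (auto simp: cell_edges_def cell_vertices_def)

lemma valency_simplicial_iso:
  assumes f: "simplicial_iso f T T" and ty: "\<And>v. v \<in> \<Union>T \<Longrightarrow> vtype (f v) = vtype v"
    and v: "v \<in> \<Union>T"
  shows "valency T (f v) = valency T v"
proof -
  note inj = simplicial_isoD(1)[OF f]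
  have E: "cell_edges T = (image f) ` cell_edges T"
    using cell_edges_image[OF inj ty] simplicial_isoD(3)[OF f] by simp
  have sub: "e \<subseteq> \<Union>T" if "e \<in> cell_edges T" for e using that by (auto simp: cell_edges_def)
  have "{e \<in> cell_edges T. f v \<in> e} = {e \<in> (image f) ` cell_edges T. f v \<in> e}" using E by simp
  also have "\<dots> = (image f) ` {e \<in> cell_edges T. f v \<in> f ` e}" by (rule Compr_image_eq)
  also have "{e \<in> cell_edges T. f v \<in> f ` e} = {e \<in> cell_edges T. v \<in> e}"
    using inj_on_image_mem_iff[OF inj v sub] by blast
  finally have "{e \<in> cell_edges T. f v \<in> e} = (image f) ` {e \<in> cell_edges T. v \<in> e}" .
  moreover have "inj_on (image f) {e \<in> cell_edges T. v \<in> e}"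
  proof (rule inj_onI)
    fix d e assume "d \<in> {e \<in> cell_edges T. v \<in> e}" "e \<in> {e \<in> cell_edges T. v \<in> e}" "f ` d = f ` e"
    then show "d = e" using inj_on_image_eq_iff[OF inj sub sub, of d e] by simp
  qed
  ultimately show ?thesis unfolding valency_def by (simp add: card_image)
qed

text \<open>\<open>Bij\<close> consists of extensional functions, so a symmetry of the triangulated
  component must first be restricted to the type 1 vertices. The other two claims say that the
  restriction still moves edges and face boundaries as \<open>f\<close> does.\<close>

lemma restrict_cell_automorphism:
  assumes f: "simplicial_iso f T T" and ty: "\<And>v. v \<in> \<Union>T \<Longrightarrow> vtype (f v) = vtype v"
  shows "restrict f (cell_vertices T) \<in> carrier (cell_automorphism_group T)"
    and "e \<in> cell_edges T \<Longrightarrow> restrict f (cell_vertices T) ` e = f ` e"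
    and "w \<in> type2_vertices T \<Longrightarrow>
      (image (restrict f (cell_vertices T))) ` face_boundary (closed_star T w)
        = face_boundary (closed_star T (f w))"
proof -
  let ?r = "restrict f (cell_vertices T)"
  note inj = simplicial_isoD(1)[OF f]
  have cv: "cell_vertices T \<subseteq> \<Union>T" by (auto simp: cell_vertices_def)
  \<comment> \<open>Both types matter: \<open>Type1\<close> makes the restriction a bijection of the
    cell vertices, \<open>Type2\<close> shows that \<open>f\<close> permutes the faces.\<close>
  have onto: "f ` {v \<in> \<Union>T. vtype v = t} = {v \<in> \<Union>T. vtype v = t}" for t
  proof -
    have "f ` {v \<in> \<Union>T. vtype v = t} = {v \<in> f ` \<Union>T. vtype v = t}"
    proof (intro equalityI subsetI)
      fix v assume "v \<in> f ` {v \<in> \<Union>T. vtype v = t}"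
      then obtain u where "v = f u" "u \<in> \<Union>T" "vtype u = t" by blast
      then show "v \<in> {v \<in> f ` \<Union>T. vtype v = t}" using ty[of u] by blast
    next
      fix v assume "v \<in> {v \<in> f ` \<Union>T. vtype v = t}"
      then obtain u where "v = f u" "u \<in> \<Union>T" "vtype v = t" by blast
      then show "v \<in> f ` {v \<in> \<Union>T. vtype v = t}" using ty[of u] by simp
    qed
    then show ?thesis using simplicial_isoD(2)[OF f] by simp
  qed
  have C: "g \<in> carrier (cell_automorphism_group T) \<longleftrightarrow> g \<in> Bij (cell_vertices T) \<and>
      (image g) ` cell_edges T = cell_edges T \<and>
      (\<lambda>F. (image g) ` face_boundary F) ` cell_faces T = face_boundary ` cell_faces T" for g
    by (simp add: cell_automorphism_group_def)
  have bij: "?r \<in> Bij (cell_vertices T)"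
    using onto[of Type1] inj_on_subset[OF inj cv] by (simp add: Bij_def bij_betw_def cell_vertices_def)
  show re: "?r ` e = f ` e" if "e \<in> cell_edges T" for e
    by (intro image_cong[OF refl] restrict_apply')
      (rule subsetD[OF cell_edges_in_vertices(1)[OF that]])
  have E: "(image f) ` cell_edges T = cell_edges T"
    using cell_edges_image[OF inj ty] simplicial_isoD(3)[OF f] by simp
  have E': "(image ?r) ` cell_edges T = cell_edges T"
    using trans[OF image_cong[OF refl re] E] by metis
  have st: "closed_star T w \<subseteq> T" for w by (auto simp: closed_star_def)
  show fb: "(image ?r) ` face_boundary (closed_star T w) = face_boundary (closed_star T (f w))"
    if w: "w \<in> type2_vertices T" for w
  proof -
    have "cell_edges (closed_star T w) \<subseteq> cell_edges T"
      unfolding cell_edges_def using st[of w] by blast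
    then have "?r ` e = f ` e" if "e \<in> cell_edges (closed_star T w)" for e
      using re that by blast
    then have "(image ?r) ` face_boundary (closed_star T w) = (image f) ` cell_edges (closed_star T w)"
      unfolding face_boundary_def by (rule image_cong[OF refl])
    also have "\<dots> = cell_edges ((image f) ` closed_star T w)"
    proof (rule cell_edges_image[symmetric])
      show "inj_on f (\<Union>(closed_star T w))" using inj Union_mono[OF st] by (rule inj_on_subset)
      show "vtype (f v) = vtype v" if "v \<in> \<Union>(closed_star T w)" for v
        using that st[of w] by (intro ty) blast
    qed
    also have "\<dots> = face_boundary (closed_star T (f w))"
      using simplicial_iso_closed_star[OF f] w by (simp add: face_boundary_def type2_vertices_def)
    finally show ?thesis .
  qed
  have "(\<lambda>F. (image ?r) ` face_boundary F) ` cell_faces T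
      = (\<lambda>w. face_boundary (closed_star T w)) ` f ` type2_vertices T"
    unfolding cell_faces_def image_image by (rule image_cong[OF refl fb])
  also have "\<dots> = face_boundary ` cell_faces T"
    unfolding cell_faces_def type2_vertices_def onto image_image ..
  finally show "?r \<in> carrier (cell_automorphism_group T)"
    using bij E' unfolding C by (intro conjI)
qed

section \<open>Triangles of \<open>X(G)\<close> and \<open>Y(G)\<close>\<close>

context group
begin

section \<open>Noncommuting pairs and conjugation\<close>

lemma noncommuting_carrier:
  assumes "noncommuting G a b"
  shows "a \<in> carrier G" "b \<in> carrier G" "a \<noteq> b"
  using assms by (auto simp: noncommuting_def)

lemma inv_mult_cancel [simp]:
  "a \<in> carrier G \<Longrightarrow> b \<in> carrier G \<Longrightarrow> inv a \<otimes> (a \<otimes> b) = b"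
  "a \<in> carrier G \<Longrightarrow> b \<in> carrier G \<Longrightarrow> a \<otimes> (inv a \<otimes> b) = b"
  by (simp_all flip: m_assoc)

text \<open>This solves \<open>a \<otimes> b = c\<close> for \<open>b\<close> within noncommuting
  pairs: the edge from \<open>(a, Type1)\<close> to \<open>(c, Type2)\<close> always bounds a
  triangle.\<close>

lemma noncommuting_divide:
  assumes "noncommuting G a c"
  shows "noncommuting G a (inv a \<otimes> c)"
proof -
  note ac = noncommuting_carrier[OF assms]
  have "inv a \<otimes> c \<otimes> a \<noteq> c"
  proof
    assume "inv a \<otimes> c \<otimes> a = c"
    then have "a \<otimes> (inv a \<otimes> (c \<otimes> a)) = a \<otimes> c" using ac by (simp add: m_assoc)
    then show False using ac assms by (simp add: noncommuting_def)
  qed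
  then show ?thesis using ac by (simp add: noncommuting_def)
qed

lemma conj_by_closed [simp]:
  "g \<in> carrier G \<Longrightarrow> a \<in> carrier G \<Longrightarrow> conj_by G g a \<in> carrier G"
  by (simp add: conj_by_def)

lemma conj_by_mult:
  "g \<in> carrier G \<Longrightarrow> a \<in> carrier G \<Longrightarrow> b \<in> carrier G \<Longrightarrow>
    conj_by G g (a \<otimes> b) = conj_by G g a \<otimes> conj_by G g b"
  by (simp add: conj_by_def m_assoc)

lemma conj_by_conj_by:
  "g \<in> carrier G \<Longrightarrow> h \<in> carrier G \<Longrightarrow> a \<in> carrier G \<Longrightarrow>
    conj_by G g (conj_by G h a) = conj_by G (g \<otimes> h) a"
  by (simp add: conj_by_def m_assoc inv_mult_group)

lemma conj_by_one [simp]: "a \<in> carrier G \<Longrightarrow> conj_by G \<one> a = a"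
  by (simp add: conj_by_def)

lemma conj_by_self [simp]: "a \<in> carrier G \<Longrightarrow> conj_by G a a = a"
  by (simp add: conj_by_def m_assoc)

lemma conj_by_inv_self [simp]: "a \<in> carrier G \<Longrightarrow> conj_by G (inv a) a = a"
  by (simp add: conj_by_def)

lemma conj_by_inv:
  "g \<in> carrier G \<Longrightarrow> a \<in> carrier G \<Longrightarrow> conj_by G g (inv a) = inv (conj_by G g a)"
  by (simp add: conj_by_def m_assoc inv_mult_group)

lemma conj_by_cancel [simp]:
  "g \<in> carrier G \<Longrightarrow> a \<in> carrier G \<Longrightarrow> conj_by G (inv g) (conj_by G g a) = a"
  "g \<in> carrier G \<Longrightarrow> a \<in> carrier G \<Longrightarrow> conj_by G g (conj_by G (inv g) a) = a"
  by (simp_all add: conj_by_conj_by)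

lemma noncommuting_conj:
  assumes "g \<in> carrier G" "noncommuting G a b"
  shows "noncommuting G (conj_by G g a) (conj_by G g b)"
proof -
  note c = noncommuting_carrier[OF assms(2)]
  have "a \<otimes> b = b \<otimes> a" if "conj_by G g (a \<otimes> b) = conj_by G g (b \<otimes> a)"
    using arg_cong[OF that, of "conj_by G (inv g)"] assms(1) c by simp
  then show ?thesis using assms c by (auto simp: noncommuting_def conj_by_mult)
qed

text \<open>The complex is pure of dimension two. Every later argument about simplices thereby
  becomes one about triangles, that is, about noncommuting pairs.\<close>

lemma X_complex_eq:
  "X_complex G = {s. s \<noteq> {} \<and> (\<exists>a b. noncommuting G a b \<and> s \<subseteq> X_triangle G a b)}"
proof (intro equalityI subsetI)
  fix s assume "s \<in> X_complex G"
  then consider (v) x t where "s = {(x, t)}" "x \<in> carrier G - group_center G"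
    | (e) x y where "s = {(x, Type1), (y, Type1)}" "noncommuting G x y"
    | (m) x y where "s = {(x, Type1), (y, Type2)}" "noncommuting G x y"
    | (f) x y where "s = X_triangle G x y" "noncommuting G x y"
    unfolding X_complex_def by blast
  then have "\<exists>a b. noncommuting G a b \<and> s \<subseteq> X_triangle G a b \<and> s \<noteq> {}"
  proof cases
    case v
    then obtain g where g: "noncommuting G x g"
      by (auto simp: group_center_def noncommuting_def)
    note gx = noncommuting_divide[OF noncommuting_mult(1)[OF g]] noncommuting_carrier[OF g]
    show ?thesis
    proof (cases t)
      case Type1
      then have "s \<subseteq> X_triangle G x g" using v(1) by (simp add: X_triangle_def)
      then show ?thesis using g v(1) by blast
    next
      \<comment> \<open>A noncentral \<open>x\<close> is the product of \<open>g\<close> and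
        \<open>inv g \<otimes> x\<close> for any \<open>g\<close> that does not commute with
        it.\<close>
      case Type2
      then have "s \<subseteq> X_triangle G g (inv g \<otimes> x)" using v(1) gx by (simp add: X_triangle_def)
      then show ?thesis using gx(1) v(1) by blast
    qed
  next
    case e
    then show ?thesis by (auto simp: X_triangle_def)
  next
    case m
    have "s \<subseteq> X_triangle G x (inv x \<otimes> y)"
      using m(1) noncommuting_carrier[OF m(2)] by (simp add: X_triangle_def)
    then show ?thesis using noncommuting_divide[OF m(2)] m(1) by blast
  next
    case f
    then show ?thesis by (auto simp: X_triangle_def)
  qed
  then show "s \<in> {s. s \<noteq> {} \<and> (\<exists>a b. noncommuting G a b \<and> s \<subseteq> X_triangle G a b)}" by blast
next
  fix s assume "s \<in> {s. s \<noteq> {} \<and> (\<exists>a b. noncommuting G a b \<and> s \<subseteq> X_triangle G a b)}"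
  then obtain a b where *: "noncommuting G a b" "s \<subseteq> X_triangle G a b" "s \<noteq> {}" by blast
  then have "X_triangle G a b \<in> X_complex G" unfolding X_complex_def by blast
  then show "s \<in> X_complex G" using simplicial_complex_face[OF simplicial_complex_X] * by blast
qed

lemma X_triangle_in_X:
  "noncommuting G a b \<Longrightarrow> X_triangle G a b \<in> X_complex G"
  unfolding X_complex_def by blast

lemma X_conj_triangle:
  assumes "g \<in> carrier G" "noncommuting G a b"
  shows "X_conj G g ` X_triangle G a b = X_triangle G (conj_by G g a) (conj_by G g b)"
  using assms(1) noncommuting_carrier[OF assms(2)] by (simp add: X_conj_def X_triangle_def conj_by_mult)

lemma X_conj_iso:
  assumes g: "g \<in> carrier G"
  shows "simplicial_iso (X_conj G g) (X_complex G) (X_complex G)"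
proof -
  have im: "X_conj G h ` s \<in> X_complex G" if h: "h \<in> carrier G" and s: "s \<in> X_complex G" for h s
  proof -
    obtain a b where *: "s \<noteq> {}" "noncommuting G a b" "s \<subseteq> X_triangle G a b"
      using s unfolding X_complex_eq by blast
    have "X_conj G h ` s \<subseteq> X_triangle G (conj_by G h a) (conj_by G h b)" "X_conj G h ` s \<noteq> {}"
      using image_mono[OF *(3), of "X_conj G h"] X_conj_triangle[OF h *(2)] *(1) by simp_all
    then show ?thesis unfolding X_complex_eq using noncommuting_conj[OF h *(2)] by blast
  qed
  have V: "fst v \<in> carrier G" if v: "v \<in> \<Union>(X_complex G)" for v
  proof -
    obtain a b where "noncommuting G a b" "v \<in> X_triangle G a b"
      using v unfolding X_complex_eq by blast
    then show ?thesis using noncommuting_carrier by (auto simp: X_triangle_def)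
  qed
  show ?thesis
  proof (rule simplicial_isoI_inverse)
    show "X_conj G (inv g) (X_conj G g v) = v" "X_conj G g (X_conj G (inv g) v) = v"
      if "v \<in> \<Union>(X_complex G)" for v
      using V[OF that] g by (cases v; simp add: X_conj_def)+
  qed (rule im; simp add: g)+
qed

text \<open>Each vertex of \<open>Y(G)\<close> occurs in some triangle, so it has one of the two forms below. Swapping
  the arguments of \<open>corner\<close> gives the other type 1 vertex of the same triangle.\<close>

definition corner :: "'a \<Rightarrow> 'a \<Rightarrow> 'a yvertex" where
  "corner a b = lift_vertex (X_complex G) {(a, Type1), (b, Type1)} (a, Type1)"

definition centre :: "'a \<Rightarrow> 'a \<Rightarrow> 'a yvertex" where
  "centre a b = lift_vertex (X_complex G) (X_triangle G a b) (a \<otimes> b, Type2)"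

lemma label_corner [simp]: "label (corner a b) = a"
  and vtype_corner [simp]: "vtype (corner a b) = Type1"
  and label_centre [simp]: "label (centre a b) = a \<otimes> b"
  and vtype_centre [simp]: "vtype (centre a b) = Type2"
  by (simp_all add: corner_def centre_def label_def vtype_def lift_vertex_def)

text \<open>Every edge of a triangle lifts a vertex to the same point as the triangle itself. The
  mixed edges matter because these are what neighbouring triangles of a sheet share.\<close>

lemma lift_vertex_triangle:
  assumes n: "noncommuting G a b"
  shows "lift_vertex (X_complex G) (X_triangle G a b) (a, Type1) = corner a b"
    and "lift_vertex (X_complex G) (X_triangle G a b) (b, Type1) = corner b a"
    and "lift_vertex (X_complex G) {(b, Type1), (a \<otimes> b, Type2)} (b, Type1) = corner b a"
    and "lift_vertex (X_complex G) {(a, Type1), (a \<otimes> b, Type2)} (a \<otimes> b, Type2) = centre a b"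
    and "lift_vertex (X_complex G) {(b, Type1), (a \<otimes> b, Type2)} (a \<otimes> b, Type2) = centre a b"
proof -
  note f = lift_vertex_face[OF simplicial_complex_X X_triangle_in_X[OF n]]
  have ab: "a \<noteq> b" using noncommuting_carrier(3)[OF n] .
  note l = f[of "{(a, Type1), (b, Type1)}"] f[of "{(b, Type1), (a \<otimes> b, Type2)}"]
    f[of "{(a, Type1), (a \<otimes> b, Type2)}"]
  show 1: "lift_vertex (X_complex G) (X_triangle G a b) (a, Type1) = corner a b"
    "lift_vertex (X_complex G) (X_triangle G a b) (b, Type1) = corner b a"
    "lift_vertex (X_complex G) {(a, Type1), (a \<otimes> b, Type2)} (a \<otimes> b, Type2) = centre a b"
    "lift_vertex (X_complex G) {(b, Type1), (a \<otimes> b, Type2)} (a \<otimes> b, Type2) = centre a b"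
    using l ab by (auto simp: corner_def centre_def X_triangle_def insert_commute)
  show "lift_vertex (X_complex G) {(b, Type1), (a \<otimes> b, Type2)} (b, Type1) = corner b a"
    unfolding 1(2)[symmetric] by (rule l(2)) (auto simp: X_triangle_def)
qed

lemma Y_edge_eq: "Y_edge G a b = (corner a b, corner b a)"
  by (simp add: Y_edge_def corner_def Let_def insert_commute)

lemma Y_triangle_eq:
  assumes "noncommuting G a b"
  shows "Y_triangle G a b = {corner a b, corner b a, centre a b}"
  unfolding Y_triangle_def lift_simplex_def using lift_vertex_triangle[OF assms]
  by (simp add: X_triangle_def[of G a b] centre_def)

lemma simplicial_complex_Y: "simplicial_complex (Y_complex G)"
  unfolding Y_complex_def by (intro simplicial_complex_desingularization simplicial_complex_X)

lemma Y_complex_eq: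
  "Y_complex G = {s. s \<noteq> {} \<and> (\<exists>a b. noncommuting G a b \<and> s \<subseteq> Y_triangle G a b)}"
proof (intro equalityI subsetI)
  let ?X = "X_complex G"
  note f = lift_vertex_face[OF simplicial_complex_X X_triangle_in_X]
  fix s assume s: "s \<in> Y_complex G"
  note Y = simplicial_complex_Y
  have "s \<noteq> {}" using simplicial_complex_simplex(2)[OF Y s] .
  moreover have "\<exists>a b. noncommuting G a b \<and> s \<subseteq> Y_triangle G a b"
    using s unfolding Y_complex_def desingularization_def
  proof (elim UnE CollectE exE conjE)
    fix v C assume *: "s = {(v, C)}" "C \<in> components (link ?X v)"
    then obtain t where t: "t \<noteq> {}" "v \<notin> t" "insert v t \<in> ?X" "C = component_of (link ?X v) t"
      by (auto simp: components_def link_def)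
    obtain a b where ab: "noncommuting G a b" "insert v t \<subseteq> X_triangle G a b"
      using t(3) unfolding X_complex_eq by blast
    \<comment> \<open>The component \<open>C\<close> is represented by the simplex \<open>t\<close>;
      enlarging \<open>insert v t\<close> to a triangle does not change the component.\<close>
    have "(v, C) = lift_vertex ?X (insert v t) v" using t by (simp add: lift_vertex_def)
    also have "\<dots> = lift_vertex ?X (X_triangle G a b) v"
      by (rule f[OF ab]) (use t in auto)
    finally have "(v, C) \<in> Y_triangle G a b"
      using ab(2) by (auto simp: Y_triangle_def lift_simplex_def)
    then show ?thesis using ab(1) *(1) by blast
  next
    fix r assume *: "s = lift_simplex ?X r" "r \<in> ?X" "2 \<le> card r"
    obtain a b where ab: "noncommuting G a b" "r \<subseteq> X_triangle G a b"
      using *(2) unfolding X_complex_eq by blast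
    have "lift_vertex ?X r v = lift_vertex ?X (X_triangle G a b) v" if "v \<in> r" for v
      by (rule f[OF ab that]) (use *(3) in auto)
    then have "s \<subseteq> Y_triangle G a b"
      using ab(2) by (auto simp: *(1) Y_triangle_def lift_simplex_def)
    then show ?thesis using ab(1) by blast
  qed
  ultimately show "s \<in> {s. s \<noteq> {} \<and> (\<exists>a b. noncommuting G a b \<and> s \<subseteq> Y_triangle G a b)}" by blast
next
  fix s assume "s \<in> {s. s \<noteq> {} \<and> (\<exists>a b. noncommuting G a b \<and> s \<subseteq> Y_triangle G a b)}"
  then obtain a b where ab: "s \<noteq> {}" "noncommuting G a b" "s \<subseteq> Y_triangle G a b" by blast
  note Y = simplicial_complex_Y
  have "2 \<le> card (X_triangle G a b)"
    using noncommuting_carrier[OF ab(2)] by (simp add: X_triangle_def)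
  then have "Y_triangle G a b \<in> Y_complex G"
    using X_triangle_in_X[OF ab(2)]
    unfolding Y_complex_def Y_triangle_def desingularization_def by blast
  then show "s \<in> Y_complex G" using simplicial_complex_face[OF Y] ab by blast
qed

lemma Y_vertex_cases:
  assumes "v \<in> \<Union>(Y_complex G)"
  obtains (corner) a b where "noncommuting G a b" "v = corner a b"
    | (centre) a b where "noncommuting G a b" "v = centre a b"
proof -
  obtain a b where "noncommuting G a b" "v \<in> Y_triangle G a b"
    using assms unfolding Y_complex_eq by blast
  then show ?thesis using that noncommuting_mult(1) Y_triangle_eq by blast
qed

lemma rotate_noncommuting:
  assumes "noncommuting G a b"
  shows "noncommuting G b (inv b \<otimes> (a \<otimes> b))" "b \<otimes> (inv b \<otimes> (a \<otimes> b)) = a \<otimes> b"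
proof -
  note c = noncommuting_carrier[OF assms]
  show "b \<otimes> (inv b \<otimes> (a \<otimes> b)) = a \<otimes> b" using c by simp
  show "noncommuting G b (inv b \<otimes> (a \<otimes> b))"
    by (rule noncommuting_divide[OF noncommuting_mult(3)[OF assms]])
qed

text \<open>The triangles of \<open>(a, b)\<close> and
  \<open>(b, inv b \<otimes> (a \<otimes> b))\<close> share the edge from \<open>(b, Type1)\<close>
  to \<open>(a \<otimes> b, Type2)\<close>, and this edge determines the lift of its type 1 end in
  both.\<close>

lemma corner_rotate:
  assumes "noncommuting G a b"
  shows "corner b (inv b \<otimes> (a \<otimes> b)) = corner b a"
proof -
  note r = rotate_noncommuting[OF assms]
  have "corner b (inv b \<otimes> (a \<otimes> b)) = lift_vertex (X_complex G) {(b, Type1), (a \<otimes> b, Type2)} (b, Type1)"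
    using lift_vertex_face[OF simplicial_complex_X X_triangle_in_X[OF r(1)],
        of "{(b, Type1), (a \<otimes> b, Type2)}" "(b, Type1)"] r(2)
      lift_vertex_triangle(1)[OF r(1)]
    by (simp add: X_triangle_def)
  then show ?thesis using lift_vertex_triangle(3)[OF assms] by simp
qed

text \<open>The other end of the same shared edge: rotation stays within one sheet.\<close>

lemma centre_rotate:
  assumes "noncommuting G a b"
  shows "centre b (inv b \<otimes> (a \<otimes> b)) = centre a b"
  using lift_vertex_triangle(4)[OF rotate_noncommuting(1)[OF assms]] lift_vertex_triangle(5)[OF assms]
    rotate_noncommuting(2)[OF assms] by simp

section \<open>The conjugation action on \<open>Y(G)\<close>\<close>

lemma Y_conj_corner:
  assumes "g \<in> carrier G" "noncommuting G a b"
  shows "Y_conj G g (corner a b) = corner (conj_by G g a) (conj_by G g b)"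
proof -
  have "{(a, Type1), (b, Type1)} \<in> X_complex G"
    unfolding X_complex_eq using assms(2) by (auto simp: X_triangle_def)
  from desingularization_map_lift_vertex[OF X_conj_iso[OF assms(1)] this]
  show ?thesis by (simp add: corner_def Y_conj_def X_conj_def)
qed

lemma Y_conj_centre:
  assumes "g \<in> carrier G" "noncommuting G a b"
  shows "Y_conj G g (centre a b) = centre (conj_by G g a) (conj_by G g b)"
proof -
  have "(a \<otimes> b, Type2) \<in> X_triangle G a b" by (simp add: X_triangle_def)
  from desingularization_map_lift_vertex[OF X_conj_iso[OF assms(1)] X_triangle_in_X[OF assms(2)] this]
    X_conj_triangle[OF assms]
  show ?thesis using assms(1) noncommuting_carrier[OF assms(2)]
    by (simp add: centre_def Y_conj_def X_conj_def conj_by_mult)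
qed

lemma Y_conj_Y_conj:
  assumes "g \<in> carrier G" "h \<in> carrier G" "v \<in> \<Union>(Y_complex G)"
  shows "Y_conj G g (Y_conj G h v) = Y_conj G (g \<otimes> h) v"
  using assms(3)
proof (cases rule: Y_vertex_cases)
  case (corner a b)
  note n = noncommuting_carrier[OF corner(1)] noncommuting_conj[OF assms(2) corner(1)]
  show ?thesis unfolding corner(2)
    using n assms(1,2) corner(1) by (simp add: Y_conj_corner conj_by_conj_by)
next
  case (centre a b)
  note n = noncommuting_carrier[OF centre(1)] noncommuting_conj[OF assms(2) centre(1)]
  show ?thesis unfolding centre(2)
    using n assms(1,2) centre(1) by (simp add: Y_conj_centre conj_by_conj_by)
qed

lemma Y_conj_one:
  assumes "v \<in> \<Union>(Y_complex G)"
  shows "Y_conj G \<one> v = v"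
  using assms
proof (cases rule: Y_vertex_cases)
  case (corner a b)
  then show ?thesis using noncommuting_carrier[OF corner(1)] Y_conj_corner[OF one_closed] by simp
next
  case (centre a b)
  then show ?thesis using noncommuting_carrier[OF centre(1)] Y_conj_centre[OF one_closed] by simp
qed

lemma Y_conj_iso:
  assumes g: "g \<in> carrier G"
  shows "simplicial_iso (Y_conj G g) (Y_complex G) (Y_complex G)"
proof -
  have im: "Y_conj G h ` s \<in> Y_complex G" if h: "h \<in> carrier G" and s: "s \<in> Y_complex G" for h s
  proof -
    obtain a b where *: "s \<noteq> {}" "noncommuting G a b" "s \<subseteq> Y_triangle G a b"
      using s unfolding Y_complex_eq by blast
    have "Y_conj G h ` Y_triangle G a b = Y_triangle G (conj_by G h a) (conj_by G h b)"
      using noncommuting_conj[OF h *(2)] *(2) noncommuting_mult(1)[OF *(2)] h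
      by (simp add: Y_triangle_eq Y_conj_corner Y_conj_centre)
    then have "Y_conj G h ` s \<subseteq> Y_triangle G (conj_by G h a) (conj_by G h b)" "Y_conj G h ` s \<noteq> {}"
      using image_mono[OF *(3), of "Y_conj G h"] *(1) by simp_all
    then show ?thesis unfolding Y_complex_eq using noncommuting_conj[OF h *(2)] by blast
  qed
  show ?thesis
  proof (rule simplicial_isoI_inverse)
    show "Y_conj G (inv g) (Y_conj G g v) = v" "Y_conj G g (Y_conj G (inv g) v) = v"
      if "v \<in> \<Union>(Y_complex G)" for v
      using g that by (simp_all add: Y_conj_Y_conj Y_conj_one)
  qed (rule im; simp add: g)+
qed

lemma vtype_Y_conj: "vtype (Y_conj G g v) = vtype v"
  by (cases v) (auto simp: Y_conj_def desingularization_map_def X_conj_def vtype_def)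

section \<open>Links and sheets\<close>

text \<open>One step of an edge path in a link. The case \<open>u = v\<close> is allowed, since
  singletons also count as steps in the definition of components.\<close>

lemma link_X_edge:
  assumes "{u, v} \<in> link (X_complex G) p"
  obtains a b where "noncommuting G a b" "{p, u, v} \<subseteq> X_triangle G a b" "p \<noteq> u" "p \<noteq> v"
proof -
  have "insert p {u, v} \<in> X_complex G" "p \<noteq> u" "p \<noteq> v"
    using assms by (auto simp: link_def)
  moreover from this(1) obtain a b where "noncommuting G a b" "{p, u, v} \<subseteq> X_triangle G a b"
    unfolding X_complex_eq mem_Collect_eq by metis
  ultimately show thesis using that by metis
qed

text \<open>This converts an equality of vertices of \<open>Y(G)\<close> into an edge path in a
  link, along which one can induct.\<close>

lemma lift_vertex_eqD:
  assumes K: "simplicial_complex K" and "{v, u} \<in> K" "{v, u'} \<in> K" "v \<noteq> u" "v \<noteq> u'"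
    and e: "lift_vertex K {v, u} v = lift_vertex K {v, u'} v"
  shows "(\<lambda>a b. {a, b} \<in> link K v)\<^sup>*\<^sup>* u u'"
proof -
  have d: "{v, u} - {v} = {u}" "{v, u'} - {v} = {u'}" using assms(4,5) by auto
  have "{u'} \<in> link K v" using assms(3,5) by (simp add: link_def insert_commute)
  then have "{u'} \<in> component_of (link K v) {u}"
    using component_of_self[OF simplicial_complex_link[OF K]] e d by (simp add: lift_vertex_def)
  then show ?thesis by (auto simp: component_of_def)
qed

text \<open>In the link of \<open>(a, Type1)\<close>, consecutive type 1 vertices are conjugate by \<open>a\<close>.\<close>

lemma corner_eq_induct:
  assumes e: "corner a b = corner a' b'" and n: "noncommuting G a b" "noncommuting G a' b'"
    and Q: "Q b" and conj: "\<And>z. z \<in> carrier G \<Longrightarrow> Q z \<Longrightarrow> Q (conj_by G a z)"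
    "\<And>z. z \<in> carrier G \<Longrightarrow> Q z \<Longrightarrow> Q (conj_by G (inv a) z)"
  shows "a' = a" "Q b'"
proof -
  show a: "a' = a" using arg_cong[OF e, of label] by simp
  note c = noncommuting_carrier[OF n(1)] noncommuting_carrier[OF n(2)]
  \<comment> \<open>A type 2 vertex of the link is recorded as \<open>a \<otimes> z\<close>, the
    product in the triangle where \<open>a\<close> comes first. Crossing such a triangle leaves
    \<open>z\<close> unchanged; crossing one where \<open>a\<close> comes second conjugates
    \<open>z\<close>.\<close>
  define I where "I u \<longleftrightarrow> (\<exists>z\<in>carrier G. Q z \<and> (u = (z, Type1) \<or> u = (a \<otimes> z, Type2)))" for u
  have "{(a, Type1), (b, Type1)} \<in> X_complex G" "{(a, Type1), (b', Type1)} \<in> X_complex G"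
    unfolding X_complex_eq using n a by (auto simp: X_triangle_def)
  from lift_vertex_eqD[OF simplicial_complex_X this] e c a
  have "(\<lambda>u v. {u, v} \<in> link (X_complex G) (a, Type1))\<^sup>*\<^sup>* (b, Type1) (b', Type1)"
    by (simp add: corner_def)
  then have "I (b', Type1)"
  proof induction
    case base
    then show ?case using Q c unfolding I_def by blast
  next
    case (step u v)
    obtain p q where pq: "noncommuting G p q" "{(a, Type1), u, v} \<subseteq> X_triangle G p q"
      "(a, Type1) \<noteq> u" "(a, Type1) \<noteq> v"
      by (rule link_X_edge[OF step(2)])
    note pc = noncommuting_carrier[OF pq(1)]
    obtain z where z: "z \<in> carrier G" "Q z" "u = (z, Type1) \<or> u = (a \<otimes> z, Type2)"
      using step.IH unfolding I_def by blast
    consider "a = p" | "a = q" "a \<noteq> p" using pq(2) by (auto simp: X_triangle_def)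
    then show ?case
    proof cases
      case 1
      then have "u \<in> {(q, Type1), (a \<otimes> q, Type2)}" "v \<in> {(q, Type1), (a \<otimes> q, Type2)}"
        using pq(2-4) by (auto simp: X_triangle_def)
      moreover from this(1) have "z = q" using z(1,3) pc 1 by auto
      ultimately show ?thesis using z(1,2) unfolding I_def by blast
    next
      case 2
      then have uv: "u \<in> {(p, Type1), (p \<otimes> a, Type2)}" "v \<in> {(p, Type1), (p \<otimes> a, Type2)}"
        using pq(2-4) by (auto simp: X_triangle_def)
      \<comment> \<open>This brings the product with \<open>a\<close> in second place into the form
        that the invariant prescribes.\<close>
      have eq: "p \<otimes> a = a \<otimes> conj_by G (inv a) p"
        using c pc by (simp add: conj_by_def m_assoc)
      have "Q p \<and> Q (conj_by G (inv a) p)"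
      proof (cases "u = (p, Type1)")
        case True
        then have "z = p" using z(3) by auto
        then show ?thesis using z conj(2) by simp
      next
        case False
        then have "a \<otimes> z = a \<otimes> conj_by G (inv a) p" using uv(1) z(3) eq by auto
        then have "z = conj_by G (inv a) p" using c pc z(1) by simp
        moreover have "p = conj_by G a z" using calculation c pc by simp
        ultimately show ?thesis using z conj(1) by simp
      qed
      then show ?thesis using uv(2) pc c eq unfolding I_def by auto
    qed
  qed
  then show "Q b'" unfolding I_def by auto
qed

section \<open>Rotation about a type 2 vertex and its period\<close>

definition next_corner :: "'a \<Rightarrow> 'a \<Rightarrow> 'a" where
  "next_corner c z = inv z \<otimes> c"

lemma next_corner_closed [simp]:
  "c \<in> carrier G \<Longrightarrow> z \<in> carrier G \<Longrightarrow> next_corner c z \<in> carrier G"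
  by (simp add: next_corner_def)

lemma funpow_next_corner_closed [simp]:
  "c \<in> carrier G \<Longrightarrow> z \<in> carrier G \<Longrightarrow> (next_corner c ^^ i) z \<in> carrier G"
  by (induction i) simp_all

lemma next_corner_mult:
  "a \<in> carrier G \<Longrightarrow> b \<in> carrier G \<Longrightarrow> next_corner (a \<otimes> b) a = b"
  by (simp add: next_corner_def)

lemma next_corner_conj:
  "g \<in> carrier G \<Longrightarrow> c \<in> carrier G \<Longrightarrow> z \<in> carrier G \<Longrightarrow>
    next_corner (conj_by G g c) (conj_by G g z) = conj_by G g (next_corner c z)"
  unfolding next_corner_def by (simp only: conj_by_mult conj_by_inv inv_closed)

lemma next_corner_inj:
  assumes "c \<in> carrier G" "z \<in> carrier G" "w \<in> carrier G" "next_corner c z = next_corner c w"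
  shows "z = w"
proof -
  have "inv z = inv w" using assms by (simp add: next_corner_def)
  then have "inv (inv z) = inv (inv w)" by simp
  then show ?thesis using assms(2,3) by simp
qed

lemma funpow_next_corner_inj:
  assumes "c \<in> carrier G" "z \<in> carrier G" "w \<in> carrier G"
    and "(next_corner c ^^ i) z = (next_corner c ^^ i) w"
  shows "z = w"
  using assms(4)
proof (induction i)
  case (Suc i)
  have "next_corner c ((next_corner c ^^ i) z) = next_corner c ((next_corner c ^^ i) w)"
    using Suc.prems by simp
  then have "(next_corner c ^^ i) z = (next_corner c ^^ i) w"
    using next_corner_inj[OF assms(1)] assms(1-3) by simp
  then show ?case by (rule Suc.IH)
qed simp

lemma funpow_next_corner_even:
  assumes "c \<in> carrier G" "z \<in> carrier G"
  shows "(next_corner c ^^ (2 * k)) z = conj_by G (inv c [^] k) z"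
proof (induction k)
  case 0
  then show ?case using assms by simp
next
  case (Suc k)
  have twice: "next_corner c (next_corner c w) = conj_by G (inv c) w" if "w \<in> carrier G" for w
    using assms(1) that by (simp add: next_corner_def conj_by_def inv_mult_group m_assoc)
  have "(next_corner c ^^ (2 * Suc k)) z = next_corner c (next_corner c ((next_corner c ^^ (2 * k)) z))"
    by simp
  also have "\<dots> = conj_by G (inv c) (conj_by G (inv c [^] k) z)"
    using assms Suc twice by simp
  also have "\<dots> = conj_by G (inv c [^] Suc k) z"
    unfolding nat_pow_Suc2[OF inv_closed[OF assms(1)]] using assms by (simp add: conj_by_conj_by)
  finally show ?case .
qed

text \<open>Even iterates are conjugations by powers of \<open>inv c\<close>, and
  \<open>inv c\<close> raised to the group order is trivial. The factor 2 appears because only a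
  double step is a conjugation.\<close>

lemma next_corner_periodic:
  assumes "finite (carrier G)" "c \<in> carrier G" "z \<in> carrier G"
  shows "(next_corner c ^^ (2 * order G)) z = z"
  using assms by (simp add: funpow_next_corner_even pow_order_eq_1)

text \<open>The link of a type 2 vertex \<open>(c, Type2)\<close> is the functional graph of \<open>next_corner c\<close>.\<close>

lemma centre_eqD:
  assumes fin: "finite (carrier G)" and e: "centre a b = centre a' b'"
    and n: "noncommuting G a b" "noncommuting G a' b'"
  shows "a' \<otimes> b' = a \<otimes> b" "\<exists>i. a' = (next_corner (a \<otimes> b) ^^ i) a"
proof -
  show ab: "a' \<otimes> b' = a \<otimes> b" using arg_cong[OF e, of label] by simp
  define c where "c = a \<otimes> b"
  note ac = noncommuting_carrier[OF n(1)] noncommuting_carrier[OF n(2)]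
  have c: "c \<in> carrier G" using ac by (simp add: c_def)
  have "{(c, Type2), (a, Type1)} \<subseteq> X_triangle G a b"
    "{(c, Type2), (a', Type1)} \<subseteq> X_triangle G a' b'"
    using ab by (simp_all add: X_triangle_def c_def)
  then have "{(c, Type2), (a, Type1)} \<in> X_complex G" "{(c, Type2), (a', Type1)} \<in> X_complex G"
    unfolding X_complex_eq using n by blast+
  from lift_vertex_eqD[OF simplicial_complex_X this] e
    lift_vertex_triangle(4)[OF n(1)] lift_vertex_triangle(4)[OF n(2)] ab
  have "(\<lambda>u v. {u, v} \<in> link (X_complex G) (c, Type2))\<^sup>*\<^sup>* (a, Type1) (a', Type1)"
    by (simp add: c_def insert_commute)
  then have "\<exists>i. (a', Type1) = ((next_corner c ^^ i) a, Type1)"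
  proof induction
    case base
    have "(a, Type1) = ((next_corner c ^^ 0) a, Type1)" by simp
    then show ?case by blast
  next
    case (step u v)
    then obtain i where i: "u = ((next_corner c ^^ i) a, Type1)" by blast
    obtain p q where pq: "noncommuting G p q" "{(c, Type2), u, v} \<subseteq> X_triangle G p q"
      "(c, Type2) \<noteq> u" "(c, Type2) \<noteq> v"
      by (rule link_X_edge[OF step(2)])
    note pc = noncommuting_carrier[OF pq(1)]
    have cpq: "c = p \<otimes> q" using pq(2) by (simp add: X_triangle_def)
    have uv: "u \<in> {(p, Type1), (q, Type1)}" "v \<in> {(p, Type1), (q, Type1)}"
      using pq(2-4) cpq by (auto simp: X_triangle_def)
    have q: "q = next_corner c p" using pc by (simp add: cpq next_corner_mult)
    \<comment> \<open>The path may cross an edge against the direction of rotation. By periodicity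
      one step back equals \<open>k\<close> steps forward, with \<open>k\<close> one less than the
      period \<open>2 * order G\<close>.\<close>
    obtain k where k: "2 * order G = Suc k" using fin order_gt_0_iff_finite by (metis Suc_pred mult_pos_pos pos2)
    have "p = (next_corner c ^^ Suc k) p" using next_corner_periodic[OF fin c pc(1)] k by simp
    then have p: "p = (next_corner c ^^ k) q" unfolding q funpow_Suc_right by simp
    consider "u = v" | "u = (p, Type1)" "v = (q, Type1)" | "u = (q, Type1)" "v = (p, Type1)"
      using uv by blast
    then show ?case
    proof cases
      case 1
      then show ?thesis using i by blast
    next
      case 2
      then have "v = ((next_corner c ^^ Suc i) a, Type1)" using i q by simp
      then show ?thesis by blast
    next
      case 3
      then have "q = (next_corner c ^^ i) a" using i by simp
      then have "v = ((next_corner c ^^ (k + i)) a, Type1)" using p 3(2) by (simp add: funpow_add)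
      then show ?thesis by blast
    qed
  qed
  then show "\<exists>i. a' = (next_corner (a \<otimes> b) ^^ i) a" by (simp add: c_def)
qed

text \<open>Consecutive iterates are the triangles met when rotating about the centre. By the last
  claim, the type 1 vertex between two adjacent triangles has the same lift in both, hence is a
  single vertex of the polygon.\<close>

lemma next_corner_sequence:
  assumes n: "noncommuting G a b" and c: "c = a \<otimes> b"
  shows "noncommuting G ((next_corner c ^^ i) a) ((next_corner c ^^ Suc i) a)"
    and "(next_corner c ^^ i) a \<otimes> (next_corner c ^^ Suc i) a = c"
    and "centre ((next_corner c ^^ i) a) ((next_corner c ^^ Suc i) a) = centre a b"
    and "corner ((next_corner c ^^ Suc i) a) ((next_corner c ^^ i) a)
      = corner ((next_corner c ^^ Suc i) a) ((next_corner c ^^ Suc (Suc i)) a)"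
proof -
  define s where "s i = (next_corner c ^^ i) a" for i
  note ac = noncommuting_carrier[OF n]
  have S: "s (Suc i) = inv (s i) \<otimes> c" for i by (simp add: s_def next_corner_def)
  have s1: "s 0 = a" "s (Suc 0) = b" using ac by (simp_all add: s_def c next_corner_mult)
  have "noncommuting G (s i) (s (Suc i)) \<and> s i \<otimes> s (Suc i) = c \<and> centre (s i) (s (Suc i)) = centre a b" for i
  proof (induction i)
    case 0
    then show ?case using n c by (simp add: s1)
  next
    case (Suc i)
    then have e: "s (Suc (Suc i)) = inv (s (Suc i)) \<otimes> (s i \<otimes> s (Suc i))" using S by simp
    show ?case unfolding e
      using Suc rotate_noncommuting[of "s i" "s (Suc i)"] centre_rotate[of "s i" "s (Suc i)"] by simp
  qed
  then show 1: "noncommuting G (s i) (s (Suc i))" "s i \<otimes> s (Suc i) = c"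
    "centre (s i) (s (Suc i)) = centre a b" by blast+
  have e: "s (Suc (Suc i)) = inv (s (Suc i)) \<otimes> (s i \<otimes> s (Suc i))" using S 1(2) by simp
  show "corner (s (Suc i)) (s i) = corner (s (Suc i)) (s (Suc (Suc i)))"
    unfolding e by (rule corner_rotate[OF 1(1), symmetric])
qed

text \<open>For a finite group a positive period exists, and the least one counts the triangles
  around the centre.\<close>

definition sheet_size :: "'a \<Rightarrow> 'a \<Rightarrow> nat" where
  "sheet_size a b = (LEAST n. 0 < n \<and> (next_corner (a \<otimes> b) ^^ n) a = a)"

text \<open>Conjugation is injective and intertwines the rotations about \<open>c\<close> and about
  the conjugate of \<open>c\<close>, so periods agree. This gives one \<open>n\<close> for all
  sheets.\<close>

lemma sheet_size_conj:
  assumes g: "g \<in> carrier G" and a: "a \<in> carrier G" and b: "b \<in> carrier G"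
  shows "sheet_size (conj_by G g a) (conj_by G g b) = sheet_size a b"
proof -
  have "(next_corner (conj_by G g a \<otimes> conj_by G g b) ^^ i) (conj_by G g a)
      = conj_by G g ((next_corner (a \<otimes> b) ^^ i) a)" for i
  proof (induction i)
    case (Suc i)
    then show ?case using next_corner_conj[OF g, of "a \<otimes> b"] g a b by (simp add: conj_by_mult)
  qed simp
  moreover have "conj_by G g z = conj_by G g w \<longleftrightarrow> z = w" if "z \<in> carrier G" "w \<in> carrier G" for z w
    using conj_by_cancel(1)[OF g that(1)] conj_by_cancel(1)[OF g that(2)] by metis
  ultimately show ?thesis using a b by (simp add: sheet_size_def)
qed

text \<open>The boundary polygon is one period of the rotation, lifted to \<open>Y(G)\<close>.
  Minimality of the period makes its vertices distinct, already by their labels, and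
  \<open>centre_eqD\<close> shows that no further triangle contains the centre.\<close>

lemma sheet_ngon:
  assumes fin: "finite (carrier G)" and n: "noncommuting G a b"
  shows "3 \<le> sheet_size a b"
    and "is_coned_ngon (sheet_size a b) (centre a b) (closed_star (Y_complex G) (centre a b))"
    and "is_ngon (sheet_size a b) (cell_edges (closed_star (Y_complex G) (centre a b)))"
proof -
  define c N where "c = a \<otimes> b" and "N = sheet_size a b"
  define s where "s i = (next_corner c ^^ i) a" for i
  define f where "f i = corner (s i) (s (Suc i))" for i
  define vs where "vs = map f [0..<N]"
  note ac = noncommuting_carrier[OF n]
  have c: "c \<in> carrier G" using ac by (simp add: c_def)
  note seq = next_corner_sequence[OF n c_def, folded s_def]
  have s0: "s 0 = a" "s (Suc 0) = b" using ac by (simp_all add: s_def c_def next_corner_mult)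
  have "0 < 2 * order G \<and> (next_corner (a \<otimes> b) ^^ (2 * order G)) a = a"
    using next_corner_periodic[OF fin c ac(1)] fin order_gt_0_iff_finite by (simp add: c_def)
  then have "0 < N \<and> (next_corner (a \<otimes> b) ^^ N) a = a" unfolding N_def sheet_size_def by (rule LeastI)
  then have N: "0 < N" "s N = a" by (simp_all add: s_def c_def)
  have least: "s k \<noteq> a" if "0 < k" "k < N" for k
    using not_less_Least[of k "\<lambda>n. 0 < n \<and> (next_corner (a \<otimes> b) ^^ n) a = a"] that
    unfolding s_def c_def N_def sheet_size_def by blast
  \<comment> \<open>Period one would give \<open>a = b\<close>; period two would give
    \<open>b \<otimes> a = a \<otimes> b\<close>.\<close>
  have "N \<noteq> 1" using N s0 ac by auto
  moreover have "N \<noteq> 2"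
  proof
    assume "N = 2"
    then have "s (Suc (Suc 0)) = a" using N by (simp add: numeral_2_eq_2)
    then have "b \<otimes> a = c" using seq(2)[of "Suc 0"] s0 by simp
    then show False using n by (simp add: c_def noncommuting_def)
  qed
  ultimately have N3: "3 \<le> N" using N(1) by linarith
  \<comment> \<open>Cancelling \<open>i\<close> rotations from a repetition gives a return to
    \<open>a\<close> after \<open>j - i\<close> steps, against minimality.\<close>
  have less: "s i \<noteq> s j" if "i < j" "j < N" for i j
  proof
    assume e: "s i = s j"
    have "(next_corner c ^^ i) a = (next_corner c ^^ i) (s (j - i))"
      using e that funpow_add[of i "j - i" "next_corner c"] unfolding s_def by simp
    moreover have "s (j - i) \<in> carrier G" using c ac by (simp add: s_def)
    ultimately have "a = s (j - i)" using funpow_next_corner_inj[OF c ac(1)] by blast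
    moreover have "0 < j - i" "j - i < N" using that by linarith+
    ultimately show False using least by metis
  qed
  have dist: "distinct vs"
  proof -
    have "inj_on f {0..<N}"
    proof (rule inj_onI)
      fix i j assume ij: "i \<in> {0..<N}" "j \<in> {0..<N}" "f i = f j"
      have "s i = s j" using arg_cong[OF ij(3), of label] by (simp add: f_def)
      then show "i = j" using less[of i j] less[of j i] ij(1,2) by (metis atLeastLessThan_iff nat_neq_iff)
    qed
    then show ?thesis by (simp add: vs_def distinct_map)
  qed
  have s_mod: "s (k mod N) = s k" for k
    unfolding s_def by (rule funpow_mod_eq[OF N(2)[unfolded s_def]])
  have s_Suc: "s (Suc k) = next_corner c (s k)" for k
    by (simp add: s_def)
  have "s (Suc (k mod N)) = s (Suc k)" for k
    by (simp add: s_Suc s_mod)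
  then have f_mod: "f (k mod N) = f k" for k using s_mod by (simp add: f_def)
  have len: "length vs = N" by (simp add: vs_def)
  \<comment> \<open>The wrap-around in \<open>polygon_edges\<close> is absorbed by the periodicity
    of \<open>f\<close>.\<close>
  have edges: "polygon_edges vs = {{f i, f (Suc i)} | i. i < N}"
  proof -
    have "vs ! i = f i" "vs ! (Suc i mod N) = f (Suc i)" if "i < N" for i
      using that N(1) f_mod[of "Suc i"] by (simp_all add: vs_def)
    then show ?thesis unfolding polygon_edges_def len by (metis (no_types, lifting))
  qed
  have tri: "Y_triangle G (s i) (s (Suc i)) = insert (centre a b) {f i, f (Suc i)}" for i
    using Y_triangle_eq[OF seq(1)] seq(3,4) by (auto simp: f_def)
  \<comment> \<open>A triangle can contain the centre only as its own type 2 vertex. Its first entry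
    is then an iterate of \<open>a\<close>, its second is determined by the product, and the index
    can be reduced modulo the period.\<close>
  have tri_iff: "noncommuting G p q \<and> centre a b \<in> Y_triangle G p q \<longleftrightarrow>
      (\<exists>i<N. p = s i \<and> q = s (Suc i))" for p q
  proof
    assume pq: "noncommuting G p q \<and> centre a b \<in> Y_triangle G p q"
    have "centre a b \<noteq> corner z w" for z w using vtype_centre vtype_corner by (metis vertex_type.distinct(1))
    then have e: "centre a b = centre p q" using pq Y_triangle_eq by auto
    from centre_eqD[OF fin e n] pq obtain k where k: "p \<otimes> q = c" "p = s k"
      by (auto simp: c_def s_def)
    have "q = s (Suc k)" using next_corner_mult[of p q] pq noncommuting_carrier[of p q] k
      by (simp add: s_Suc)
    then have "p = s (k mod N)" "q = s (Suc (k mod N))" "k mod N < N"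
      using k(2) N(1) by (simp_all add: s_Suc s_mod)
    then show "\<exists>i<N. p = s i \<and> q = s (Suc i)" by blast
  next
    assume "\<exists>i<N. p = s i \<and> q = s (Suc i)"
    then show "noncommuting G p q \<and> centre a b \<in> Y_triangle G p q" using seq(1) tri by blast
  qed
  have "closed_star (Y_complex G) (centre a b)
      = {t. t \<noteq> {} \<and> (\<exists>p q. (noncommuting G p q \<and> centre a b \<in> Y_triangle G p q) \<and> t \<subseteq> Y_triangle G p q)}"
    unfolding closed_star_def Y_complex_eq by blast
  also have "\<dots> = {t. t \<noteq> {} \<and> (\<exists>i<N. t \<subseteq> insert (centre a b) {f i, f (Suc i)})}"
    unfolding tri_iff using tri by blast
  also have "\<dots> = {t. t \<noteq> {} \<and> (\<exists>e\<in>polygon_edges vs. t \<subseteq> insert (centre a b) e)}"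
    unfolding edges by blast
  finally have star: "closed_star (Y_complex G) (centre a b)
      = {t. t \<noteq> {} \<and> (\<exists>e\<in>polygon_edges vs. t \<subseteq> insert (centre a b) e)}" .
  have vs1: "vtype v = Type1" if "v \<in> set vs" for v
    using that by (auto simp: vs_def f_def)
  have notin: "centre a b \<notin> set vs" using vs1[of "centre a b"] by auto
  show "3 \<le> sheet_size a b" using N3 by (simp add: N_def)
  show "is_coned_ngon (sheet_size a b) (centre a b) (closed_star (Y_complex G) (centre a b))"
    unfolding is_coned_ngon_def N_def[symmetric] using N3 len dist notin star by blast
  have "cell_edges (closed_star (Y_complex G) (centre a b)) = polygon_edges vs"
    unfolding star by (rule cell_edges_cone) (use N3 len dist vs1 in simp_all)
  then show "is_ngon (sheet_size a b) (cell_edges (closed_star (Y_complex G) (centre a b)))"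
    unfolding is_ngon_def N_def[symmetric] using N3 len dist by blast
qed

section \<open>The component of a triangle\<close>

lemma generate_closed:
  assumes "S \<subseteq> carrier G"
  shows "h \<in> generate G S \<Longrightarrow> h \<in> carrier G"
    and "g \<in> generate G S \<Longrightarrow> h \<in> generate G S \<Longrightarrow> g \<otimes> h \<in> generate G S"
    and "h \<in> generate G S \<Longrightarrow> inv h \<in> generate G S"
    and "g \<in> generate G S \<Longrightarrow> h \<in> generate G S \<Longrightarrow> conj_by G g h \<in> generate G S"
  using generate_incl[OF assms] generate_m_inv_closed[OF assms]
  by (auto simp: conj_by_def intro: generate.eng)

text \<open>The ordered pairs \<open>(a, b)\<close> for which the triangle of \<open>(a, b)\<close> lies in the component of the triangle
  of \<open>(x, y)\<close>.\<close>

definition edge_orbit :: "'a \<Rightarrow> 'a \<Rightarrow> ('a \<times> 'a) set" where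
  "edge_orbit x y =
     {(conj_by G h a, conj_by G h b) | h a b. h \<in> generate G {x, y} \<and>
        ((a, b) = (x, y) \<or> (a, b) = (y, inv y \<otimes> x \<otimes> y))}"

lemma edge_orbit_cases:
  assumes "(a, b) \<in> edge_orbit x y"
  obtains (first) h where "h \<in> generate G {x, y}" "a = conj_by G h x" "b = conj_by G h y"
    | (second) h where "h \<in> generate G {x, y}" "a = conj_by G h y"
        "b = conj_by G h (inv y \<otimes> x \<otimes> y)"
  using assms unfolding edge_orbit_def by blast

lemma edge_orbitI:
  assumes "h \<in> generate G {x, y}"
  shows "(conj_by G h x, conj_by G h y) \<in> edge_orbit x y"
    and "(conj_by G h y, conj_by G h (inv y \<otimes> x \<otimes> y)) \<in> edge_orbit x y"
  using assms unfolding edge_orbit_def by blast+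

section \<open>Closure of the orbit of triangles under adjacency\<close>

context
  fixes x y
  assumes n: "noncommuting G x y"
begin

lemmas n_carrier = noncommuting_carrier[OF n]

lemma gen_carrier: "{x, y} \<subseteq> carrier G"
  using n_carrier by simp

lemmas gen_closed = generate_closed[OF gen_carrier]

lemma gen_base: "x \<in> generate G {x, y}" "y \<in> generate G {x, y}"
  by (simp_all add: generate.incl)

lemma second_edge:
  "noncommuting G y (inv y \<otimes> x \<otimes> y)" "inv y \<otimes> x \<otimes> y \<in> generate G {x, y}"
  "conj_by G y (inv y \<otimes> x \<otimes> y) = x"
  using rotate_noncommuting[OF n] n_carrier gen_base gen_closed(2,3)
  by (simp_all add: m_assoc conj_by_def)

lemma edge_orbit_base: "(x, y) \<in> edge_orbit x y"
  using edge_orbitI(1)[OF generate.one, of x y] n_carrier by simp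

lemma edge_orbit_conj:
  assumes "(a, b) \<in> edge_orbit x y" "g \<in> generate G {x, y}"
  shows "(conj_by G g a, conj_by G g b) \<in> edge_orbit x y"
  using assms(1)
proof (cases rule: edge_orbit_cases)
  case (first h)
  then show ?thesis
    using edge_orbitI(1)[OF gen_closed(2)[OF assms(2) first(1)]] gen_closed(1) assms(2) n_carrier
    by (simp add: conj_by_conj_by)
next
  case (second h)
  then show ?thesis
    using edge_orbitI(2)[OF gen_closed(2)[OF assms(2) second(1)]] gen_closed(1) assms(2)
      noncommuting_carrier[OF second_edge(1)]
    by (simp add: conj_by_conj_by)
qed

lemma edge_orbitD:
  assumes "(a, b) \<in> edge_orbit x y"
  shows "a \<in> generate G {x, y}" "b \<in> generate G {x, y}" "noncommuting G a b"
  using assms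
  by (cases rule: edge_orbit_cases;
      simp add: gen_closed gen_base second_edge noncommuting_conj n)+

text \<open>Swapping commutes with conjugation, so only the base pairs need checking:
  \<open>(y, x)\<close> is a \<open>y\<close>-conjugate of the second one, and the second one
  reversed is an \<open>inv y\<close>-conjugate of the first.\<close>

lemma edge_orbit_swap:
  assumes "(a, b) \<in> edge_orbit x y"
  shows "(b, a) \<in> edge_orbit x y"
  using assms
proof (cases rule: edge_orbit_cases)
  case (first h)
  have "(conj_by G y y, conj_by G y (inv y \<otimes> x \<otimes> y)) \<in> edge_orbit x y"
    by (rule edge_orbitI(2)[OF gen_base(2)])
  then have "(y, x) \<in> edge_orbit x y" using n_carrier second_edge(3) by simp
  then show ?thesis using edge_orbit_conj first by simp
next
  case (second h)
  have "(conj_by G (inv y) x, conj_by G (inv y) y) \<in> edge_orbit x y"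
    by (rule edge_orbitI(1)[OF gen_closed(3)[OF gen_base(2)]])
  then have "(inv y \<otimes> x \<otimes> y, y) \<in> edge_orbit x y" using n_carrier by (simp add: conj_by_def)
  then show ?thesis using edge_orbit_conj second by simp
qed

text \<open>The entry \<open>a\<close> belongs to the generated subgroup, so conjugation by
  \<open>a\<close> or \<open>inv a\<close> preserves the orbit, and it fixes \<open>a\<close>. Hence
  \<open>(a, z)\<close> stays in the orbit along any path in the link.\<close>

lemma edge_orbit_corner:
  assumes "(a, b) \<in> edge_orbit x y" and n': "noncommuting G a' b'" and e: "corner a b = corner a' b'"
  shows "(a', b') \<in> edge_orbit x y"
proof -
  note o = edge_orbitD[OF assms(1)]
  have a: "a \<in> carrier G" using gen_closed(1) o(1) .
  have "(a, conj_by G g z) \<in> edge_orbit x y"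
    if "(a, z) \<in> edge_orbit x y" "g \<in> {a, inv a}" for g z
    using edge_orbit_conj[OF that(1), of g] that(2) o(1) gen_closed(3) a by auto
  then have "(a, b') \<in> edge_orbit x y" "a' = a"
    using corner_eq_induct[OF e o(3) n', of "\<lambda>z. (a, z) \<in> edge_orbit x y"] assms(1) by blast+
  then show ?thesis by simp
qed

text \<open>One rotation takes \<open>(p, q)\<close> to the conjugate of \<open>(q, p)\<close> by
  \<open>inv q\<close>. Since \<open>q\<close> lies in the generated subgroup, this is a swap
  followed by an admissible conjugation.\<close>

lemma edge_orbit_centre:
  assumes fin: "finite (carrier G)" and o: "(a, b) \<in> edge_orbit x y"
    and n': "noncommuting G a' b'" and e: "centre a b = centre a' b'"
  shows "(a', b') \<in> edge_orbit x y"
proof -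
  let ?s = "\<lambda>i. (next_corner (a \<otimes> b) ^^ i) a"
  have nab: "noncommuting G a b" by (rule edge_orbitD(3)[OF o])
  note ab = noncommuting_carrier[OF nab]
  have seq: "(?s i, ?s (Suc i)) \<in> edge_orbit x y" for i
  proof (induction i)
    case 0
    then show ?case using o ab by (simp add: next_corner_mult)
  next
    case (Suc i)
    let ?p = "?s i" and ?q = "?s (Suc i)"
    note pq = noncommuting_carrier[OF edge_orbitD(3)[OF Suc]]
    have c: "?p \<otimes> ?q = a \<otimes> b" by (rule next_corner_sequence(2)[OF nab refl])
    have "?s (Suc (Suc i)) = inv ?q \<otimes> (?p \<otimes> ?q)"
      unfolding c by (simp add: next_corner_def)
    also have "\<dots> = conj_by G (inv ?q) ?p"
      using pq by (simp add: conj_by_def m_assoc del: funpow.simps)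
    finally have 1: "?s (Suc (Suc i)) = conj_by G (inv ?q) ?p" .
    have "(conj_by G (inv ?q) ?q, conj_by G (inv ?q) ?p) \<in> edge_orbit x y"
      by (rule edge_orbit_conj[OF edge_orbit_swap[OF Suc] gen_closed(3)[OF edge_orbitD(2)[OF Suc]]])
    then show ?case unfolding 1 conj_by_inv_self[OF pq(2)] .
  qed
  obtain i where i: "a' = ?s i" using centre_eqD(2)[OF fin e nab n'] by blast
  have "b' = ?s (Suc i)"
    using next_corner_mult[of a' b'] noncommuting_carrier[OF n'] centre_eqD(1)[OF fin e nab n'] i by simp
  then show ?thesis using seq[of i] i by simp
qed

lemma Y_triangle_in_Y: "Y_triangle G x y \<in> Y_complex G"
  unfolding Y_complex_eq Y_triangle_eq[OF n] using n Y_triangle_eq[OF n] by blast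

lemma edge_orbit_meets:
  assumes fin: "finite (carrier G)" and o: "(a, b) \<in> edge_orbit x y"
    and n': "noncommuting G a' b'" and v: "v \<in> Y_triangle G a b" "v \<in> Y_triangle G a' b'"
  shows "(a', b') \<in> edge_orbit x y"
proof -
  have ne: "corner p q \<noteq> centre r s" for p q r s
    using vtype_centre vtype_corner by (metis vertex_type.distinct(1))
  note nab = edge_orbitD(3)[OF o]
  consider "v = centre a b" "v = centre a' b'"
    | p q p' q' where "v = corner p q" "v = corner p' q'" "(p, q) = (a, b) \<or> (p, q) = (b, a)"
      "(p', q') = (a', b') \<or> (p', q') = (b', a')"
    using v ne unfolding Y_triangle_eq[OF n'] Y_triangle_eq[OF nab] by (metis empty_iff insert_iff)
  then show ?thesis
  proof cases
    case 1
    then show ?thesis using edge_orbit_centre[OF fin o n'] by simp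
  next
    case 2
    have "(p, q) \<in> edge_orbit x y" using o edge_orbit_swap 2(3) by auto
    moreover have "noncommuting G p' q'" using n' noncommuting_mult(1) 2(4) by auto
    ultimately have "(p', q') \<in> edge_orbit x y" using edge_orbit_corner 2(1,2) by metis
    then show ?thesis using edge_orbit_swap 2(4) by auto
  qed
qed

text \<open>The vertices of the triangles in the orbit form a set that no edge of
  \<open>Y(G)\<close> leaves, because a triangle meeting an orbit triangle in one vertex is again in
  the orbit.\<close>

lemma component_triangle:
  assumes fin: "finite (carrier G)"
    and s: "s \<in> component_of (Y_complex G) (Y_triangle G x y)"
  obtains a b where "(a, b) \<in> edge_orbit x y" "s \<noteq> {}" "s \<subseteq> Y_triangle G a b"
proof -
  let ?V = "\<Union>(a, b)\<in>edge_orbit x y. Y_triangle G a b"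
  have meets: "(a, b) \<in> edge_orbit x y"
    if "u \<in> ?V" "noncommuting G a b" "u \<in> Y_triangle G a b" for u a b
    using that edge_orbit_meets[OF fin] by blast
  obtain u v where uv: "u \<in> Y_triangle G x y" "v \<in> s" "s \<in> Y_complex G"
    "(\<lambda>a b. {a, b} \<in> Y_complex G)\<^sup>*\<^sup>* u v"
    using s unfolding component_of_def by blast
  have "v \<in> ?V" using uv(4)
  proof induction
    case base
    then show ?case using uv(1) edge_orbit_base by blast
  next
    case (step w z)
    obtain a b where "noncommuting G a b" "{w, z} \<subseteq> Y_triangle G a b"
      using step(2) unfolding Y_complex_eq by blast
    then show ?case using meets[OF step.IH] by blast
  qed
  moreover obtain a b where "noncommuting G a b" "s \<subseteq> Y_triangle G a b" "s \<noteq> {}"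
    using uv(3) unfolding Y_complex_eq by blast
  ultimately show thesis using meets uv(2) that by blast
qed

end

end

section \<open>Vertices, sheets, edges and symmetries of the component\<close>

theorem theorem2p30:
  fixes G :: "('a, 'b) monoid_scheme" (structure)
    and x y :: 'a
    and T :: "'a yvertex set set"
  assumes "group G" and "finite (carrier G)" and "\<not> comm_group G"
    and "x \<in> carrier G" and "y \<in> carrier G" and "x \<otimes> y \<noteq> y \<otimes> x"
    and "T \<in> components (Y_complex G)" and "Y_triangle G x y \<in> T"
  defines "H \<equiv> generate G {x, y}"
    and "vx \<equiv> lift_vertex (X_complex G) (X_triangle G x y) (x, Type1)"
    and "vy \<equiv> lift_vertex (X_complex G) (X_triangle G x y) (y, Type1)"
  shows
    "(\<forall>v\<in>\<Union>T. vtype v = Type1 \<longrightarrow>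
        (\<exists>h\<in>H. label v = conj_by G h x \<or> label v = conj_by G h y)) \<and>
     (\<forall>w\<in>\<Union>T. vtype w = Type2 \<longrightarrow>
        (\<exists>h\<in>H. label w = conj_by G h (x \<otimes> y))) \<and>
     (\<forall>w\<in>type2_vertices T. \<forall>w'\<in>type2_vertices T. \<exists>h\<in>H.
        simplicial_iso (Y_conj G h) (closed_star (Y_complex G) w) (closed_star (Y_complex G) w')) \<and>
     (\<exists>n\<ge>3.
        (\<forall>w\<in>type2_vertices T. is_coned_ngon n w (closed_star (Y_complex G) w)) \<and>
        (\<forall>F\<in>cell_faces T. is_ngon n (face_boundary F))) \<and>
     (\<forall>v\<in>cell_vertices T. \<exists>h\<in>H.
        (v = Y_conj G h vx \<and> valency T v = valency T vx) \<or>
        (v = Y_conj G h vy \<and> valency T v = valency T vy)) \<and>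
     (\<forall>(u, v)\<in>cell_oriented_edges T. \<exists>h\<in>H.
        (u, v) = map_prod (Y_conj G h) (Y_conj G h) (Y_edge G x y) \<or>
        (u, v) = map_prod (Y_conj G h) (Y_conj G h) (Y_edge G y (inv y \<otimes> x \<otimes> y))) \<and>
     (\<forall>e\<in>cell_edges T. \<forall>e'\<in>cell_edges T. \<exists>h\<in>H. Y_conj G h ` e = e') \<and>
     face_transitive T \<and> edge_transitive T"
proof -
  interpret group G by fact
  let ?Y = "Y_complex G"
  have fin: "finite (carrier G)" by fact
  have n: "noncommuting G x y" using assms by (simp add: noncommuting_def)
  note xy = noncommuting_carrier[OF n] and Hc = gen_closed[OF n, folded H_def]
    and edge2 = second_edge[OF n, folded H_def]
  have Ysub: "T \<subseteq> ?Y" and T: "T = component_of ?Y (Y_triangle G x y)"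
  proof -
    obtain r where r: "r \<in> ?Y" "T = component_of ?Y r"
      using \<open>T \<in> components ?Y\<close> by (auto simp: components_def)
    then show "T \<subseteq> ?Y" by (auto simp: component_of_def)
    show "T = component_of ?Y (Y_triangle G x y)"
      using component_of_eqI[OF simplicial_complex_Y r(1)] \<open>Y_triangle G x y \<in> T\<close> r(2) by simp
  qed
  have vx: "vx = corner x y" and vy: "vy = corner y x"
    unfolding vx_def vy_def by (rule lift_vertex_triangle[OF n])+
  have tri: "\<exists>a b. (a, b) \<in> edge_orbit x y \<and> s \<noteq> {} \<and> s \<subseteq> {corner a b, corner b a, centre a b}"
    if "s \<in> T" for s
    using component_triangle[OF n fin, of s] that Y_triangle_eq edge_orbitD(3)[OF n] unfolding T by metis
  \<comment> \<open>By rotation the second base pair has first corner \<open>corner y x\<close> and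
    centre \<open>centre x y\<close>. So it adds no new class of vertices or sheets, although it may
    add a class of oriented edges.\<close>
  have second_conj: "corner (conj_by G h y) (conj_by G h (inv y \<otimes> x \<otimes> y)) = Y_conj G h (corner y x)"
    "centre (conj_by G h y) (conj_by G h (inv y \<otimes> x \<otimes> y)) = Y_conj G h (centre x y)" if "h \<in> H" for h
    using corner_rotate[OF n] centre_rotate[OF n] Y_conj_corner[OF Hc(1)[OF that] edge2(1)]
      Y_conj_centre[OF Hc(1)[OF that] edge2(1)] xy by (simp_all add: m_assoc)
  have type1: "\<exists>h\<in>H. v = Y_conj G h (corner x y) \<and> label v = conj_by G h x
      \<or> v = Y_conj G h (corner y x) \<and> label v = conj_by G h y"
    if v: "v \<in> \<Union>T" "vtype v = Type1" for v
  proof -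
    obtain a b where ab: "(a, b) \<in> edge_orbit x y" "v \<in> {corner a b, corner b a, centre a b}"
      using v(1) tri by blast
    then have "v = corner a b \<or> v = corner b a" using v(2) by auto
    \<comment> \<open>Closure under swapping allows the vertex to be taken as the first corner of
      its pair.\<close>
    then obtain p q where pq: "(p, q) \<in> edge_orbit x y" "v = corner p q"
      using ab(1) edge_orbit_swap[OF n] by blast
    from pq(1) show ?thesis
    proof (cases rule: edge_orbit_cases)
      case (first h)
      note 1 = first[folded H_def]
      have "v = Y_conj G h (corner x y)" "label v = conj_by G h x"
        using pq(2) 1 Y_conj_corner[OF Hc(1)[OF 1(1)] n] by simp_all
      then show ?thesis using 1(1) by blast
    next
      case (second h)
      note 2 = second[folded H_def]
      have "v = Y_conj G h (corner y x)" "label v = conj_by G h y"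
        using pq(2) 2 second_conj(1)[OF 2(1)]
          Y_conj_corner[OF Hc(1)[OF 2(1)] noncommuting_mult(1)[OF n]] by simp_all
      then show ?thesis using 2(1) by blast
    qed
  qed
  have type2: "\<exists>h\<in>H. w = Y_conj G h (centre x y)" if w: "w \<in> \<Union>T" "vtype w = Type2" for w
  proof -
    obtain a b where ab: "(a, b) \<in> edge_orbit x y" "w \<in> {corner a b, corner b a, centre a b}"
      using w(1) tri by blast
    then have wab: "w = centre a b" using w(2) by auto
    from ab(1) show ?thesis
    proof (cases rule: edge_orbit_cases)
      case (first h)
      note 1 = first[folded H_def]
      have "w = Y_conj G h (centre x y)"
        using wab 1 Y_conj_centre[OF Hc(1)[OF 1(1)] n] by simp
      then show ?thesis using 1(1) by blast
    next
      case (second h)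
      note 2 = second[folded H_def]
      have "w = Y_conj G h (centre x y)"
        using wab 2 second_conj(2)[OF 2(1)] by simp
      then show ?thesis using 2(1) by blast
    qed
  qed
  have oriented: "\<exists>h\<in>H. (u, v) = map_prod (Y_conj G h) (Y_conj G h) (Y_edge G x y) \<or>
      (u, v) = map_prod (Y_conj G h) (Y_conj G h) (Y_edge G y (inv y \<otimes> x \<otimes> y))"
    if uv: "{u, v} \<in> cell_edges T" for u v
  proof -
    have uv': "{u, v} \<in> T" "u \<noteq> v" "vtype u = Type1" "vtype v = Type1"
      using uv by (auto simp: cell_edges_def)
    obtain a b where ab: "(a, b) \<in> edge_orbit x y" "{u, v} \<subseteq> {corner a b, corner b a, centre a b}"
      using tri[OF uv'(1)] by blast
    then have "(u, v) = (corner a b, corner b a) \<or> (u, v) = (corner b a, corner a b)"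
      using uv'(2-4) by auto
    then obtain p q where pq: "(p, q) \<in> edge_orbit x y" "(u, v) = (corner p q, corner q p)"
      using ab(1) edge_orbit_swap[OF n] by blast
    from pq(1) show ?thesis
    proof (cases rule: edge_orbit_cases)
      case (first h)
      note 1 = first[folded H_def]
      have "(u, v) = map_prod (Y_conj G h) (Y_conj G h) (Y_edge G x y)"
        using pq(2) 1 Y_conj_corner[OF Hc(1)[OF 1(1)] n]
          Y_conj_corner[OF Hc(1)[OF 1(1)] noncommuting_mult(1)[OF n]]
        by (simp add: Y_edge_eq)
      then show ?thesis using 1(1) by blast
    next
      case (second h)
      note 2 = second[folded H_def]
      have "(u, v) = map_prod (Y_conj G h) (Y_conj G h) (Y_edge G y (inv y \<otimes> x \<otimes> y))"
        using pq(2) 2 Y_conj_corner[OF Hc(1)[OF 2(1)] edge2(1)]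
          Y_conj_corner[OF Hc(1)[OF 2(1)] noncommuting_mult(1)[OF edge2(1)]]
        by (simp add: Y_edge_eq)
      then show ?thesis using 2(1) by blast
    qed
  qed
  have in_Y: "corner x y \<in> \<Union>?Y" "corner y x \<in> \<Union>?Y" "centre x y \<in> \<Union>?Y"
    using Y_triangle_in_Y[OF n] unfolding Y_triangle_eq[OF n] by blast+
  have TY: "v \<in> \<Union>?Y" if "v \<in> \<Union>T" for v using that Ysub by blast
  \<comment> \<open>Two conjugates of one base point, by \<open>h\<close> and by \<open>g\<close>,
    differ by conjugation with \<open>g \<otimes> inv h\<close>, again in \<open>H\<close>.\<close>
  have conj2: "Y_conj G (g \<otimes> inv h) (Y_conj G h v) = Y_conj G g v"
    if "g \<in> H" "h \<in> H" "v \<in> \<Union>?Y" for g h v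
    using that Hc(1) by (simp add: Y_conj_Y_conj m_assoc)
  \<comment> \<open>An automorphism carries components to components. The image of a simplex at
    \<open>v\<close> meets \<open>T\<close> in the image of \<open>v\<close>, hence lies in
    \<open>T\<close>, so the image of \<open>T\<close> is the component \<open>T\<close>.\<close>
  have T_iso: "simplicial_iso (Y_conj G h) T T"
    if h: "h \<in> H" and v: "v \<in> \<Union>?Y" "v \<in> \<Union>T" "Y_conj G h v \<in> \<Union>T" for h v
  proof -
    note iso = Y_conj_iso[OF Hc(1)[OF h]]
    obtain s t where st: "s \<in> T" "v \<in> s" "t \<in> T" "Y_conj G h v \<in> t" using v by blast
    have comp: "component_of ?Y r = T" if "r \<in> T" for r
      using component_of_eqI[OF simplicial_complex_Y Y_triangle_in_Y[OF n]] that by (simp add: T)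
    have "Y_conj G h ` s \<in> component_of ?Y t"
      using component_of_meets[OF simplicial_complex_Y component_of_self[OF simplicial_complex_Y, of t],
          of "Y_conj G h ` s" "Y_conj G h v"] st Ysub simplicial_isoD(4)[OF iso, of s] by blast
    then have "Y_conj G h ` s \<in> T" using comp[OF st(3)] by blast
    moreover have "s \<subseteq> \<Union>?Y" using st(1) Ysub by blast
    ultimately have "(image (Y_conj G h)) ` T = T"
      using simplicial_iso_component_of[OF iso, of s] comp st(1) by simp
    moreover have "inj_on (Y_conj G h) (\<Union>T)"
      using simplicial_isoD(1)[OF iso] Ysub by (auto intro: inj_on_subset)
    ultimately show ?thesis by (intro simplicial_isoI)
  qed
  have base_T: "corner x y \<in> \<Union>T" "corner y x \<in> \<Union>T" "centre x y \<in> \<Union>T"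
    using \<open>Y_triangle G x y \<in> T\<close> unfolding Y_triangle_eq[OF n] by blast+

  have 1: "\<forall>v\<in>\<Union>T. vtype v = Type1 \<longrightarrow>
        (\<exists>h\<in>H. label v = conj_by G h x \<or> label v = conj_by G h y)"
    using type1 by blast
  have 2: "\<forall>w\<in>\<Union>T. vtype w = Type2 \<longrightarrow> (\<exists>h\<in>H. label w = conj_by G h (x \<otimes> y))"
  proof (intro ballI impI)
    fix w assume "w \<in> \<Union>T" "vtype w = Type2"
    then obtain h where h: "h \<in> H" "w = Y_conj G h (centre x y)" using type2 by blast
    then have "label w = conj_by G h (x \<otimes> y)"
      using Y_conj_centre[OF Hc(1) n] Hc(1) xy by (simp add: conj_by_mult)
    then show "\<exists>h\<in>H. label w = conj_by G h (x \<otimes> y)" using h(1) by blast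
  qed
  have type2_conj: "\<exists>h\<in>H. w' = Y_conj G h w" if w: "w \<in> type2_vertices T" "w' \<in> type2_vertices T" for w w'
  proof -
    obtain g h where "g \<in> H" "h \<in> H" "w = Y_conj G h (centre x y)" "w' = Y_conj G g (centre x y)"
      using w type2 unfolding type2_vertices_def by blast
    then show ?thesis using conj2[of g h] in_Y(3) Hc(2,3) by metis
  qed
  have 3: "\<forall>w\<in>type2_vertices T. \<forall>w'\<in>type2_vertices T. \<exists>h\<in>H.
        simplicial_iso (Y_conj G h) (closed_star ?Y w) (closed_star ?Y w')"
  proof (intro ballI)
    fix w w' assume w: "w \<in> type2_vertices T" "w' \<in> type2_vertices T"
    then obtain h where h: "h \<in> H" "w' = Y_conj G h w" using type2_conj by blast
    have "w \<in> \<Union>?Y" using w(1) TY by (simp only: type2_vertices_def mem_Collect_eq)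
    then show "\<exists>h\<in>H. simplicial_iso (Y_conj G h) (closed_star ?Y w) (closed_star ?Y w')"
      using simplicial_iso_restrict_closed_star[OF Y_conj_iso[OF Hc(1)[OF h(1)]]] h by blast
  qed
  have star_T: "closed_star T w = closed_star ?Y w" if "w \<in> \<Union>T" for w
    using closed_star_component_of[OF simplicial_complex_Y] that unfolding T .
  \<comment> \<open>The sheet is a conjugate of the one about \<open>centre x y\<close>, and
    \<open>sheet_size\<close> is invariant under conjugation.\<close>
  have sheet: "is_coned_ngon (sheet_size x y) w (closed_star ?Y w) \<and>
      is_ngon (sheet_size x y) (face_boundary (closed_star T w))" if w: "w \<in> type2_vertices T" for w
  proof -
    have wT: "w \<in> \<Union>T" "vtype w = Type2" using w unfolding type2_vertices_def by blast+
    then obtain h where h: "h \<in> H" "w = Y_conj G h (centre x y)" using type2 by blast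
    have "w = centre (conj_by G h x) (conj_by G h y)"
      using h Y_conj_centre[OF Hc(1) n] by simp
    moreover note sheet_ngon[OF fin noncommuting_conj[OF Hc(1)[OF h(1)] n]]
      sheet_size_conj[OF Hc(1)[OF h(1)] xy(1,2)]
    ultimately show ?thesis using star_T[OF wT(1)] by (simp add: face_boundary_def)
  qed
  have 4: "\<exists>n\<ge>3.
        (\<forall>w\<in>type2_vertices T. is_coned_ngon n w (closed_star ?Y w)) \<and>
        (\<forall>F\<in>cell_faces T. is_ngon n (face_boundary F))"
    using sheet sheet_ngon(1)[OF fin n] unfolding cell_faces_def by blast
  have 5: "\<forall>v\<in>cell_vertices T. \<exists>h\<in>H.
        (v = Y_conj G h vx \<and> valency T v = valency T vx) \<or>
        (v = Y_conj G h vy \<and> valency T v = valency T vy)"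
  proof
    fix v assume "v \<in> cell_vertices T"
    then have v: "v \<in> \<Union>T" "vtype v = Type1" unfolding cell_vertices_def by blast+
    then obtain h u where h: "h \<in> H" "v = Y_conj G h u" "u = vx \<or> u = vy"
      using type1 unfolding vx vy by blast
    have u: "u \<in> \<Union>T" using h(3) base_T unfolding vx vy by blast
    have "simplicial_iso (Y_conj G h) T T" using T_iso[OF h(1) TY[OF u] u] v(1) h(2) by simp
    then have "valency T v = valency T u"
      unfolding h(2) by (rule valency_simplicial_iso[OF _ vtype_Y_conj u])
    then show "\<exists>h\<in>H. (v = Y_conj G h vx \<and> valency T v = valency T vx) \<or>
        (v = Y_conj G h vy \<and> valency T v = valency T vy)" using h by blast
  qed
  have 6: "\<forall>(u, v)\<in>cell_oriented_edges T. \<exists>h\<in>H.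
        (u, v) = map_prod (Y_conj G h) (Y_conj G h) (Y_edge G x y) \<or>
        (u, v) = map_prod (Y_conj G h) (Y_conj G h) (Y_edge G y (inv y \<otimes> x \<otimes> y))"
    unfolding cell_oriented_edges_def using oriented by blast
  have edge_base: "\<exists>h\<in>H. e = Y_conj G h ` {corner x y, corner y x}" if e: "e \<in> cell_edges T" for e
  proof -
    obtain u v where uv: "e = {u, v}" using e unfolding cell_edges_def card_2_iff by blast
    obtain h where h: "h \<in> H" and cases: "(u, v) = map_prod (Y_conj G h) (Y_conj G h) (Y_edge G x y) \<or>
        (u, v) = map_prod (Y_conj G h) (Y_conj G h) (Y_edge G y (inv y \<otimes> x \<otimes> y))"
      using oriented[of u v] e uv by blast
    from cases show ?thesis
    proof
      assume "(u, v) = map_prod (Y_conj G h) (Y_conj G h) (Y_edge G x y)"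
      then show ?thesis using uv h by (auto simp: Y_edge_eq)
    next
      assume uv2: "(u, v) = map_prod (Y_conj G h) (Y_conj G h) (Y_edge G y (inv y \<otimes> x \<otimes> y))"
      have y: "inv y \<in> H" using Hc(3) gen_base(2)[OF n] unfolding H_def by blast
      \<comment> \<open>The second base edge is the \<open>inv y\<close>-conjugate of the first with
        its ends exchanged. As unoriented edges the two classes therefore coincide.\<close>
      have "corner y (inv y \<otimes> x \<otimes> y) = Y_conj G (inv y) (corner y x)"
        "corner (inv y \<otimes> x \<otimes> y) y = Y_conj G (inv y) (corner x y)"
        using Y_conj_corner[OF Hc(1)[OF y] n] Y_conj_corner[OF Hc(1)[OF y] noncommuting_mult(1)[OF n]] xy
        by (simp_all add: conj_by_def)
      then have "e = Y_conj G (h \<otimes> inv y) ` {corner x y, corner y x}"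
        using uv uv2 in_Y Hc(1)[OF h] Hc(1)[OF y] by (auto simp: Y_edge_eq Y_conj_Y_conj)
      then show ?thesis using Hc(2)[OF h y] by blast
    qed
  qed
  have 7: "\<forall>e\<in>cell_edges T. \<forall>e'\<in>cell_edges T. \<exists>h\<in>H. Y_conj G h ` e = e'"
  proof (intro ballI)
    fix e e' assume "e \<in> cell_edges T" "e' \<in> cell_edges T"
    then obtain g h where gh: "g \<in> H" "h \<in> H" "e = Y_conj G h ` {corner x y, corner y x}"
      "e' = Y_conj G g ` {corner x y, corner y x}" using edge_base by metis
    then have "Y_conj G (g \<otimes> inv h) ` e = e'"
      using conj2[OF gh(1,2)] in_Y by simp
    then show "\<exists>h\<in>H. Y_conj G h ` e = e'" using gh(1,2) Hc(2,3) by blast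
  qed
  have 8: "face_transitive T"
    unfolding face_transitive_def cell_faces_def
  proof (intro ballI)
    fix F F' assume "F \<in> closed_star T ` type2_vertices T" "F' \<in> closed_star T ` type2_vertices T"
    then obtain w w' where w: "w \<in> type2_vertices T" "w' \<in> type2_vertices T"
      "F = closed_star T w" "F' = closed_star T w'" by blast
    obtain h where h: "h \<in> H" "w' = Y_conj G h w" using type2_conj[OF w(1,2)] by blast
    have wT: "w \<in> \<Union>T" "w' \<in> \<Union>T" using w(1,2) unfolding type2_vertices_def by blast+
    have "simplicial_iso (Y_conj G h) T T" using T_iso[OF h(1) TY[OF wT(1)] wT(1)] wT(2) h(2) by simp
    from restrict_cell_automorphism(1,3)[OF this vtype_Y_conj] w h(2)
    show "\<exists>f\<in>carrier (cell_automorphism_group T). (image f) ` face_boundary F = face_boundary F'"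
      by blast
  qed
  have 9: "edge_transitive T"
    unfolding edge_transitive_def
  proof (intro ballI)
    fix e e' assume e: "e \<in> cell_edges T" "e' \<in> cell_edges T"
    then obtain h where h: "h \<in> H" "Y_conj G h ` e = e'" using 7 by blast
    \<comment> \<open>A vertex of \<open>e\<close> is mapped into \<open>e'\<close>, hence into
      \<open>T\<close>; it is the point that \<open>T_iso\<close> asks for.\<close>
    obtain v where "v \<in> e" using cell_edges_in_vertices(2)[OF e(1)] by blast
    moreover have "e \<in> T" "e' \<in> T" using e by (simp_all add: cell_edges_def)
    ultimately have v: "v \<in> \<Union>T" "Y_conj G h v \<in> \<Union>T" using h(2) by blast+
    from restrict_cell_automorphism(1,2)[OF T_iso[OF h(1) TY[OF v(1)] v] vtype_Y_conj] e(1) h(2)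
    show "\<exists>f\<in>carrier (cell_automorphism_group T). f ` e = e'" by blast
  qed
  show ?thesis using 1 2 3 4 5 6 7 8 9 by (intro conjI)
qed

end
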